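(* Let $Z$ be the total space of an affine line bundle fibred over $\mathcal O(3)\to\mathbb{P}^1$ with patching $$\hat\zeta=\lambda\zeta+f(S),\qquad \hat S=\lambda^{-3}S,$$ where $f(S)$ is a polynomial of at least quadratic order. Then $Z$ is a Newtonian twistor space: the Kodaira moduli space $M$ of global sections is locally a complex Newton-Cartan spacetime (with respect to the geometry induced by the frame). \begin{itemize} \item The normal bundle is generically $N_x=\mathcal O\oplus\mathcal O(2)$. \item At special points the normal bundle jumps to $\mathcal O(-1)\oplus\mathcal O(3)$; at these jumping points the time axis in the moduli space becomes singular (the clock vanishes). \end{itemize} The special points are characterised by the vanishing of the three two-forms induced on $M$ by the global two-form $d\hat\zeta\wedge d\hat S$, or equivalently by the vanishing of the constant term $\gamma_0$ in the Laurent expansion in $\lambda$ of $\frac{\partial f}{\partial S}|$.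
   Context: Cover $\mathbb{P}^1$ by $U,\hat U$ with coordinates $\lambda$ and $\hat\lambda=\lambda^{-1}$; $\mathcal O(k)$ has patching $\hat w=\lambda^{-k}w$. The fibre coordinates of $Z\to\mathbb{P}^1$ are $w=(\zeta,S)$ over $U$ and $\hat w=(\hat\zeta,\hat S)$ over $\hat U$. $M$ is the space of global sections $X_x$ of $Z\to\mathbb{P}^1$, with $S|=x_0+x_1\lambda+x_2\lambda^2+x_3\lambda^3$, so that $x=(x_0,x_1,x_2,x_3)$ are coordinates on $M$. A vertical slash denotes restriction to $X_x$; $N_x$ is the normal bundle of $X_x$, with patching $\mathcal F^\mu_{\ \nu}=\frac{\partial\hat w^\mu}{\partial w^\nu}|$. On $Z$ one has $d\hat\zeta\wedge d\hat S=\lambda^{-2}d\zeta\wedge dS$ along the fibres of $Z\to\mathbb{P}^1$; restricted to the sections (with $d$ the exterior derivative on $M$ at fixed $\lambda$) this is a quadratic polynomial in $\hat\lambda$, whose three coefficients are the three two-forms on $M$. Where $N_x\cong\mathcal O\oplus\mathcal O(2)$, write $\mathcal F=\hat H\,\mathrm{diag}(1,\lambda^{-2})H^{-1}$ with $H$, $\hat H$ holomorphic maps to $\mathrm{GL}(2,\mathbb{C})$ from $U$, $\hat U$, defined up to invertible global sections of $N_x\otimes N_x^*$. The frame section $H^{-1}dw|$ has first component a one-form $\theta$ (the clock, defined up to a non-vanishing factor) and second component a quadratic polynomial in $\lambda$ with one-form coefficients, whose discriminant gives (up to a non-vanishing conformal factor) a degenerate covariant spatial metric. The clock is, up to a non-vanishing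 factor, a one-form that extends holomorphically to all of $M$. A complex four-dimensional Newton-Cartan spacetime is a complex four-manifold with a symmetric contravariant metric $h$ of rank three, a closed one-form $\theta$ spanning its kernel (the clock), and a torsion-free affine connection $\nabla$ with $\nabla h=0$, $\nabla\theta=0$; here $h$ is the inverse, on $\ker\theta$, of the induced covariant spatial metric.
   Formalization: Since the clock is fixed only up to a non-vanishing factor where the frame exists, its zeros are undetermined; it is normalised by the global two-form (det H = 1, with rank-three spatial metric extending to M). The Newton-Cartan structure is asserted where the normal bundle is O+O(2). *)

theory Defs
  imports "HOL-Complex_Analysis.Complex_Analysis"
begin

section \<open>Holomorphic calculus on \<open>\<complex>\<^sup>n\<close>\<close>

text \<open>
  Coordinates on \<open>M\<close> have type \<^typ>\<open>complex^4\<close>, and the index type \<^typ>\<open>4\<close> is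
  read as \<open>{0, 1, 2, 3}\<close> (the residues modulo 4), so that \<open>x $ k\<close> is \<open>x\<^sub>k\<close>. Fibre coordinates
  \<open>w = (\<zeta>, S)\<close> have type \<^typ>\<open>complex^2\<close> with \<open>\<zeta> = w $ 1\<close> and \<open>S = w $ 2\<close>. Tensor fields
  are given by their components in the coordinates \<open>x\<close>.
\<close>

text \<open>Complex differentiability in several variables: a Frechet derivative that is complex linear.\<close>

definition mholo :: "(complex^'n) set \<Rightarrow> (complex^'n \<Rightarrow> complex) \<Rightarrow> bool" where
  "mholo W g \<longleftrightarrow>
     (\<forall>x\<in>W. \<exists>D. (g has_derivative D) (at x) \<and> (\<forall>c v. D (c *s v) = c * D v))"

definition pd :: "'n \<Rightarrow> (complex^'n \<Rightarrow> complex) \<Rightarrow> complex^'n \<Rightarrow> complex" where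
  "pd i g x = deriv (\<lambda>t. g (x + axis i t)) 0"

definition holo_form :: "(complex^'n) set \<Rightarrow> (complex^'n \<Rightarrow> complex^'n) \<Rightarrow> bool" where
  "holo_form W \<alpha> \<longleftrightarrow> (\<forall>i. mholo W (\<lambda>x. \<alpha> x $ i))"

definition closed_form :: "(complex^'n) set \<Rightarrow> (complex^'n \<Rightarrow> complex^'n) \<Rightarrow> bool" where
  "closed_form W \<alpha> \<longleftrightarrow> (\<forall>x\<in>W. \<forall>i j. pd i (\<lambda>y. \<alpha> y $ j) x = pd j (\<lambda>y. \<alpha> y $ i) x)"

definition wedge :: "complex^'n \<Rightarrow> complex^'n \<Rightarrow> complex^'n^'n" where
  "wedge \<alpha> \<beta> = (\<chi> i j. \<alpha> $ i * \<beta> $ j - \<alpha> $ j * \<beta> $ i)"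

definition contract :: "complex^'n \<Rightarrow> complex^'n \<Rightarrow> complex" where
  "contract \<alpha> v = (\<Sum>i\<in>UNIV. \<alpha> $ i * v $ i)"


section \<open>The twistor space and its sections\<close>

text \<open>The patching \<open>(\<zeta>, S) \<mapsto> (\<lambda>\<zeta> + f(S), \<lambda>\<^sup>-\<^sup>3 S)\<close> over \<open>\<lambda> \<noteq> 0\<close>.\<close>

definition patch :: "complex poly \<Rightarrow> complex \<Rightarrow> complex^2 \<Rightarrow> complex^2" where
  "patch f l w = vector [l * w $ 1 + poly f (w $ 2), l powi (-3) * w $ 2]"

text \<open>
  A global section is a pair of holomorphic maps \<open>w\<close>, \<open>w'\<close> on the two charts, related by the
  patching. The second map is a function of the coordinate \<open>1/\<lambda>\<close>.
\<close>

definition sections :: "complex poly \<Rightarrow> ((complex \<Rightarrow> complex^2) \<times> (complex \<Rightarrow> complex^2)) set" where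
  "sections f = {(w, w').
     (\<forall>\<mu>. (\<lambda>z. w z $ \<mu>) holomorphic_on UNIV) \<and>
     (\<forall>\<mu>. (\<lambda>z. w' z $ \<mu>) holomorphic_on UNIV) \<and>
     (\<forall>z. z \<noteq> 0 \<longrightarrow> w' (1/z) = patch f z (w z))}"

definition cubic :: "complex^4 \<Rightarrow> complex \<Rightarrow> complex" where
  "cubic x l = x $ 0 + x $ 1 * l + x $ 2 * l^2 + x $ 3 * l^3"

definition has_coords ::
  "(complex \<Rightarrow> complex^2) \<times> (complex \<Rightarrow> complex^2) \<Rightarrow> complex^4 \<Rightarrow> bool" where
  "has_coords p x \<longleftrightarrow> (\<forall>l. fst p l $ 2 = cubic x l)"

definition curve ::
  "complex poly \<Rightarrow> complex^4 \<Rightarrow> (complex \<Rightarrow> complex^2) \<times> (complex \<Rightarrow> complex^2)" where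
  "curve f x = (THE p. p \<in> sections f \<and> has_coords p x)"

definition wU :: "complex poly \<Rightarrow> complex^4 \<Rightarrow> complex \<Rightarrow> complex^2" where
  "wU f x = fst (curve f x)"

definition wV :: "complex poly \<Rightarrow> complex^4 \<Rightarrow> complex \<Rightarrow> complex^2" where
  "wV f x = snd (curve f x)"

text \<open>Row \<open>\<mu>\<close> is the one-form \<open>dw\<^sup>\<mu>|\<close> on \<open>M\<close>, taken at fixed \<open>\<lambda>\<close> (resp. fixed \<open>1/\<lambda>\<close>).\<close>

definition dwU :: "complex poly \<Rightarrow> complex^4 \<Rightarrow> complex \<Rightarrow> complex^4^2" where
  "dwU f x l = (\<chi> \<mu> i. pd i (\<lambda>y. wU f y l $ \<mu>) x)"

definition dwV :: "complex poly \<Rightarrow> complex^4 \<Rightarrow> complex \<Rightarrow> complex^4^2" where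
  "dwV f x m = (\<chi> \<mu> i. pd i (\<lambda>y. wV f y m $ \<mu>) x)"

text \<open>\<open>\<Sigma> 0\<close>, \<open>\<Sigma> 1\<close>, \<open>\<Sigma> 2\<close> are the coefficients of the restricted two-form, a quadratic in \<open>1/\<lambda>\<close>.\<close>

definition induced_two_forms ::
  "complex poly \<Rightarrow> (nat \<Rightarrow> complex^4 \<Rightarrow> complex^4^4) \<Rightarrow> bool" where
  "induced_two_forms f \<Sigma> \<longleftrightarrow>
     (\<forall>k\<le>2. \<forall>i j. mholo UNIV (\<lambda>x. \<Sigma> k x $ i $ j)) \<and>
     (\<forall>x m i j. wedge (dwV f x m $ 1) (dwV f x m $ 2) $ i $ j = (\<Sum>k\<le>2. m^k * \<Sigma> k x $ i $ j))"

text \<open>Constant term of the Laurent expansion in \<open>\<lambda>\<close> of \<open>\<partial>f/\<partial>S|\<close>.\<close>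

definition gamma0 :: "complex poly \<Rightarrow> complex^4 \<Rightarrow> complex" where
  "gamma0 f x = fls_nth (laurent_expansion (\<lambda>l. poly (pderiv f) (wU f x l $ 2)) 0) 0"


section \<open>The normal bundle\<close>

definition normal_patch :: "complex poly \<Rightarrow> complex^4 \<Rightarrow> complex \<Rightarrow> complex^2^2" where
  "normal_patch f x l = (\<chi> \<mu> \<nu>. pd \<nu> (\<lambda>w. patch f l w $ \<mu>) (wU f x l))"

definition diag2 :: "complex \<Rightarrow> complex \<Rightarrow> complex^2^2" where
  "diag2 a b = vector [vector [a, 0], vector [0, b]]"

text \<open>
  An isomorphism of the bundle with patching \<open>F\<close> onto \<open>\<O>(a) \<oplus> \<O>(b)\<close>; \<open>H'\<close> is a function of \<open>1/\<lambda>\<close>,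
  and \<open>\<O>(k)\<close> has patching \<open>\<lambda>\<^sup>-\<^sup>k\<close>.
\<close>

definition splitting ::
  "(complex \<Rightarrow> complex^2^2) \<Rightarrow> int \<Rightarrow> int \<Rightarrow> (complex \<Rightarrow> complex^2^2) \<Rightarrow> (complex \<Rightarrow> complex^2^2) \<Rightarrow> bool"
where
  "splitting F a b H H' \<longleftrightarrow>
     (\<forall>i j. (\<lambda>z. H z $ i $ j) holomorphic_on UNIV) \<and> (\<forall>z. invertible (H z)) \<and>
     (\<forall>i j. (\<lambda>z. H' z $ i $ j) holomorphic_on UNIV) \<and> (\<forall>z. invertible (H' z)) \<and>
     (\<forall>z. z \<noteq> 0 \<longrightarrow>
        F z = H' (1/z) ** diag2 (z powi (-a)) (z powi (-b)) ** matrix_inv (H z))"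

definition normal_type :: "complex poly \<Rightarrow> int \<Rightarrow> int \<Rightarrow> (complex^4) set" where
  "normal_type f a b = {x. \<exists>H H'. splitting (normal_patch f x) a b H H'}"


section \<open>The frame, the clock and the spatial metric\<close>

text \<open>
  The frame section \<open>H\<^sup>-\<^sup>1 dw|\<close> has first component \<open>\<theta>\<close>, independent of \<open>\<lambda>\<close>, and second component
  the quadratic polynomial \<open>e 0 + \<lambda> e 1 + \<lambda>\<^sup>2 e 2\<close>.
\<close>

definition frame_forms ::
  "complex poly \<Rightarrow> complex^4 \<Rightarrow> (complex \<Rightarrow> complex^2^2) \<Rightarrow> complex^4 \<Rightarrow> (nat \<Rightarrow> complex^4) \<Rightarrow> bool"
where
  "frame_forms f x H \<theta> e \<longleftrightarrow>
     (\<forall>l. (matrix_inv (H l) ** dwU f x l) $ 1 = \<theta> \<and>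
          (matrix_inv (H l) ** dwU f x l) $ 2 = (\<Sum>k\<le>2. l^k *s e k))"

text \<open>
  Discriminant \<open>e\<^sub>1\<^sup>2 - 4 e\<^sub>0 e\<^sub>2\<close> of the quadratic, as a symmetric matrix.
\<close>

definition disc_metric :: "(nat \<Rightarrow> complex^4) \<Rightarrow> complex^4^4" where
  "disc_metric e =
     (\<chi> i j. e 1 $ i * e 1 $ j - 2 * (e 0 $ i * e 2 $ j + e 2 $ i * e 0 $ j))"

text \<open>A splitting \<open>N\<^sub>x \<cong> \<O> \<oplus> \<O>(2)\<close> at each \<open>x\<close> of an open set, depending holomorphically on \<open>x\<close>.\<close>

definition holo_frame ::
  "complex poly \<Rightarrow> (complex^4) set \<Rightarrow> (complex^4 \<Rightarrow> complex \<Rightarrow> complex^2^2) \<Rightarrow>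
     (complex^4 \<Rightarrow> complex \<Rightarrow> complex^2^2) \<Rightarrow> bool"
where
  "holo_frame f W H H' \<longleftrightarrow>
     open W \<and> (\<forall>x\<in>W. splitting (normal_patch f x) 0 2 (H x) (H' x)) \<and>
     (\<forall>z i j. mholo W (\<lambda>x. H x z $ i $ j)) \<and> (\<forall>z i j. mholo W (\<lambda>x. H' x z $ i $ j))"

text \<open>
  A splitting determines \<open>\<theta>\<close> only up to a non-vanishing factor on the locus \<open>\<O> \<oplus> \<O>(2)\<close>, which does
  not decide where an extension of it across the jumping points vanishes. The clock on all of
  \<open>M\<close> is therefore normalised by the global two-form: on that locus it comes from splittings with
  \<open>det H = 1\<close>, i.e. those for which \<open>\<theta> \<and> (e\<^sub>0 + \<lambda> e\<^sub>1 + \<lambda>\<^sup>2 e\<^sub>2) = d\<zeta> \<and> dS|\<close>, whose spatial forms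
  extend holomorphically to all of \<open>M\<close> with a metric of rank three. This fixes \<open>\<theta>\<close> on \<open>M\<close> up to a
  non-vanishing holomorphic factor.
\<close>

definition global_clock :: "complex poly \<Rightarrow> (complex^4 \<Rightarrow> complex^4) \<Rightarrow> bool" where
  "global_clock f \<theta> \<longleftrightarrow>
     holo_form UNIV \<theta> \<and>
     (\<exists>e. (\<forall>k\<le>2. holo_form UNIV (e k)) \<and>
          (\<forall>x. rank (disc_metric (\<lambda>k. e k x)) = 3) \<and>
          (\<forall>x\<in>normal_type f 0 2. \<exists>H H'. splitting (normal_patch f x) 0 2 H H' \<and>
              (\<forall>l. det (H l) = 1) \<and> frame_forms f x H (\<theta> x) (\<lambda>k. e k x)))"


section \<open>Complex Newton-Cartan spacetimes\<close>

text \<open>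
  On an open subset \<open>W\<close> of \<open>\<complex>\<^sup>4\<close>: \<open>\<Gamma> x i j k\<close> is the Christoffel symbol \<open>\<Gamma>\<^sup>i\<^sub>j\<^sub>k\<close>.
\<close>

definition newton_cartan ::
  "(complex^4) set \<Rightarrow> (complex^4 \<Rightarrow> complex^4^4) \<Rightarrow> (complex^4 \<Rightarrow> complex^4) \<Rightarrow>
     (complex^4 \<Rightarrow> 4 \<Rightarrow> 4 \<Rightarrow> 4 \<Rightarrow> complex) \<Rightarrow> bool"
where
  "newton_cartan W h \<theta> \<Gamma> \<longleftrightarrow>
     open W \<and>
     (\<forall>i j. mholo W (\<lambda>x. h x $ i $ j)) \<and> holo_form W \<theta> \<and>
     (\<forall>i j k. mholo W (\<lambda>x. \<Gamma> x i j k)) \<and>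
     (\<forall>x\<in>W. transpose (h x) = h x \<and> rank (h x) = 3 \<and>
        (\<forall>\<alpha>. h x *v \<alpha> = 0 \<longleftrightarrow> (\<exists>c. \<alpha> = c *s \<theta> x))) \<and>
     closed_form W \<theta> \<and>
     (\<forall>x\<in>W. \<forall>i j k. \<Gamma> x i j k = \<Gamma> x i k j) \<and>
     (\<forall>x\<in>W. \<forall>i j k.
        pd k (\<lambda>y. h y $ i $ j) x
          + (\<Sum>l\<in>UNIV. \<Gamma> x i k l * h x $ l $ j) + (\<Sum>l\<in>UNIV. \<Gamma> x j k l * h x $ i $ l) = 0) \<and>
     (\<forall>x\<in>W. \<forall>j k. pd k (\<lambda>y. \<theta> y $ j) x - (\<Sum>l\<in>UNIV. \<Gamma> x l k j * \<theta> x $ l) = 0)"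

text \<open>
  \<open>h\<close> inverts the covariant metric \<open>g\<close> on \<open>ker \<theta>\<close>.
\<close>

definition inverse_on_kernel :: "complex^4 \<Rightarrow> complex^4^4 \<Rightarrow> complex^4^4 \<Rightarrow> bool" where
  "inverse_on_kernel \<theta> g h \<longleftrightarrow> (\<forall>v. contract \<theta> v = 0 \<longrightarrow> h *v (g *v v) = v)"

text \<open>
  The frame-induced geometry is locally Newton-Cartan on the locus \<open>N\<^sub>x \<cong> \<O> \<oplus> \<O>(2)\<close>. Holomorphic frames
  exist near each point; each of them induces a clock and a spatial metric, and suitable
  representatives up to non-vanishing factors are those of a Newton-Cartan spacetime.
\<close>

definition locally_newton_cartan :: "complex poly \<Rightarrow> bool" where
  "locally_newton_cartan f \<longleftrightarrow>
     (\<forall>x\<in>normal_type f 0 2. \<exists>W H H'. x \<in> W \<and> holo_frame f W H H') \<and>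
     (\<forall>W H H'. holo_frame f W H H' \<longrightarrow>
        (\<exists>\<theta> e. (\<forall>x\<in>W. frame_forms f x (H x) (\<theta> x) (\<lambda>k. e k x)) \<and>
          (\<forall>x\<in>W. \<exists>V a b h \<Gamma>. x \<in> V \<and> V \<subseteq> W \<and>
             mholo V a \<and> mholo V b \<and> (\<forall>y\<in>V. a y \<noteq> 0 \<and> b y \<noteq> 0) \<and>
             newton_cartan V h (\<lambda>y. a y *s \<theta> y) \<Gamma> \<and>
             (\<forall>y\<in>V. inverse_on_kernel (\<theta> y)
                (\<chi> i j. b y * disc_metric (\<lambda>k. e k y) $ i $ j) (h y)))))"

end

theory Submission
  imports Defs "HOL-Computational_Algebra.Fundamental_Theorem_Algebra"
begin

text \<open>
  On the overlap \<open>\<lambda>\<zeta> + f(S|)\<close> is entire both in \<open>\<lambda>\<close> and in \<open>1/\<lambda>\<close>, hence constant: the sections are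
  \<open>\<zeta> = (f(x\<^sub>0) - f(S|))/\<lambda>\<close>, and \<open>\<gamma>\<^sub>0 = f'(x\<^sub>0)\<close>. Writing \<open>f'(S|) = \<gamma>\<^sub>0 + \<lambda>g\<close>, column operations
  reduce the normal patching to \<open>diag(\<lambda>, \<lambda>\<^sup>-\<^sup>3)\<close> when \<open>\<gamma>\<^sub>0 = 0\<close> and to \<open>diag(1, \<lambda>\<^sup>-\<^sup>2)\<close> otherwise, in the
  latter case with clock \<open>\<gamma>\<^sub>0 dx\<^sub>0\<close> and spatial forms \<open>dx\<^sub>1 + \<lambda> dx\<^sub>2 + \<lambda>\<^sup>2 dx\<^sub>3\<close>. By Liouville's theorem any
  other frame differs from this one by a lower triangular matrix with constant diagonal, so up to
  factors the induced geometry is flat.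
\<close>

(* Both fps_nth and vec_nth are written $; without this every formula with several
   components has exponentially many parse trees. *)
no_notation fps_nth (infixl "$" 75)

section \<open>Holomorphic functions\<close>

named_theorems mholo_intros

lemma mholo_imp_continuous_on:
  assumes "mholo W g"
  shows "continuous_on W g"
  using assms unfolding mholo_def
  by (meson continuous_at_imp_continuous_on has_derivative_continuous)

lemma mholo_const [mholo_intros]: "mholo W (\<lambda>x. c)"
  unfolding mholo_def by (auto intro!: exI[of _ "\<lambda>_. 0"])

lemma mholo_nth [mholo_intros]: "mholo W (\<lambda>x. x $ i)"
  unfolding mholo_def
  by (intro ballI exI[of _ "\<lambda>v. v $ i"])
     (auto intro: bounded_linear_imp_has_derivative[OF bounded_linear_vec_nth])

lemma mholo_add [mholo_intros]:
  assumes "mholo W g" "mholo W h"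
  shows "mholo W (\<lambda>x. g x + h x)"
  unfolding mholo_def
proof
  fix x assume "x \<in> W"
  then obtain A B where "(g has_derivative A) (at x)" "\<forall>c v. A (c *s v) = c * A v"
    "(h has_derivative B) (at x)" "\<forall>c v. B (c *s v) = c * B v"
    using assms unfolding mholo_def by meson
  then show "\<exists>D. ((\<lambda>x. g x + h x) has_derivative D) (at x) \<and> (\<forall>c v. D (c *s v) = c * D v)"
    by (intro exI[of _ "\<lambda>v. A v + B v"]) (auto intro!: has_derivative_add simp: algebra_simps)
qed

lemma mholo_mult [mholo_intros]:
  assumes "mholo W g" "mholo W h"
  shows "mholo W (\<lambda>x. g x * h x)"
  unfolding mholo_def
proof
  fix x assume "x \<in> W"
  then obtain A B where "(g has_derivative A) (at x)" "\<forall>c v. A (c *s v) = c * A v"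
    "(h has_derivative B) (at x)" "\<forall>c v. B (c *s v) = c * B v"
    using assms unfolding mholo_def by meson
  then show "\<exists>D. ((\<lambda>x. g x * h x) has_derivative D) (at x) \<and> (\<forall>c v. D (c *s v) = c * D v)"
    by (intro exI[of _ "\<lambda>v. g x * B v + A v * h x"] conjI has_derivative_mult)
       (auto simp: algebra_simps)
qed

lemma mholo_compose:
  assumes "mholo W g" "\<And>x. x \<in> W \<Longrightarrow> (h has_field_derivative h' x) (at (g x))"
  shows "mholo W (\<lambda>x. h (g x))"
  unfolding mholo_def
proof
  fix x assume "x \<in> W"
  then obtain A where A: "(g has_derivative A) (at x)" "\<forall>c v. A (c *s v) = c * A v"
    using assms(1) unfolding mholo_def by meson
  have "((\<lambda>x. h (g x)) has_derivative (\<lambda>v. h' x * A v)) (at x)"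
    using has_derivative_compose[OF A(1)] assms(2)[OF \<open>x \<in> W\<close>]
    by (simp add: has_field_derivative_def)
  then show "\<exists>D. ((\<lambda>x. h (g x)) has_derivative D) (at x) \<and> (\<forall>c v. D (c *s v) = c * D v)"
    using A(2) by (intro exI[of _ "\<lambda>v. h' x * A v"]) (auto simp: algebra_simps)
qed

lemma mholo_uminus [mholo_intros]: "mholo W g \<Longrightarrow> mholo W (\<lambda>x. - g x)"
  using mholo_mult[OF mholo_const[of W "-1"], of g] by simp

lemma mholo_diff [mholo_intros]: "mholo W g \<Longrightarrow> mholo W h \<Longrightarrow> mholo W (\<lambda>x. g x - h x)"
  using mholo_add[OF _ mholo_uminus, of W g h] by simp

lemma mholo_power [mholo_intros]: "mholo W g \<Longrightarrow> mholo W (\<lambda>x. g x ^ n)"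
  by (induction n) (auto intro: mholo_intros)

lemma mholo_poly [mholo_intros]: "mholo W g \<Longrightarrow> mholo W (\<lambda>x. poly p (g x))"
  by (rule mholo_compose[OF _ poly_DERIV])

lemma mholo_divide [mholo_intros]:
  assumes "mholo W g" "mholo W h" "\<And>x. x \<in> W \<Longrightarrow> h x \<noteq> 0"
  shows "mholo W (\<lambda>x. g x / h x)"
proof -
  have "mholo W (\<lambda>x. inverse (h x))"
    by (rule mholo_compose[OF assms(2) DERIV_inverse[OF assms(3)]])
  from mholo_mult[OF assms(1) this] show ?thesis by (simp add: divide_inverse)
qed

lemma pd_eqI: "((\<lambda>t. g (x + axis i t)) has_field_derivative c) (at 0) \<Longrightarrow> pd i g x = c"
  unfolding pd_def by (rule DERIV_imp_deriv)

lemma pd_const [simp]: "pd i (\<lambda>x. c) x = 0"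
  by (rule pd_eqI) auto

section \<open>Entire functions on the two charts of the projective line\<close>

lemma entire_eq_punctured:
  fixes u v :: "complex \<Rightarrow> complex"
  assumes "u holomorphic_on UNIV" "v holomorphic_on UNIV" "\<And>z. z \<noteq> 0 \<Longrightarrow> u z = v z"
  shows "u z = v z"
proof (cases "z = 0")
  case True
  have "isCont u 0" "isCont v 0"
    using assms(1,2) by (auto intro!: continuous_on_interior holomorphic_on_imp_continuous_on)
  then have "(u \<longlongrightarrow> u 0) (at 0)" "(v \<longlongrightarrow> v 0) (at 0)"
    by (auto simp: isCont_def)
  moreover have "\<forall>\<^sub>F z in at 0. u z = v z"
    using assms(3) by (auto simp: eventually_at intro!: exI[of _ 1])
  ultimately have "(u \<longlongrightarrow> u 0) (at 0)" "(u \<longlongrightarrow> v 0) (at 0)"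
    by (auto simp: tendsto_cong)
  then have "u 0 = v 0"
    by (rule LIM_unique)
  with True show ?thesis by simp
qed (use assms in simp)

text \<open>\<open>v\<close> is bounded on the closed unit disc, so \<open>u\<close> grows at most
  like \<open>norm z ^ n\<close> outside it and Liouville's theorem applies. Geometrically this
  computes the global sections of \<open>O(n)\<close>.\<close>

lemma entire_pole_infinity_poly:
  fixes u v :: "complex \<Rightarrow> complex"
  assumes u: "u holomorphic_on UNIV" and v: "v holomorphic_on UNIV"
    and uv: "\<And>z. z \<noteq> 0 \<Longrightarrow> u z = z ^ n * v (1 / z)"
  shows "\<exists>c. \<forall>z. u z = (\<Sum>k\<le>n. c k * z ^ k)"
proof -
  have "compact (v ` cball 0 1)"
    using v by (intro compact_continuous_image)
      (auto intro: holomorphic_on_imp_continuous_on continuous_on_subset)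
  then obtain B where "\<forall>m\<in>cball 0 1. norm (v m) \<le> B"
    using compact_imp_bounded[of "v ` cball 0 1"] unfolding bounded_iff by auto
  then have B: "\<And>m. norm m \<le> 1 \<Longrightarrow> norm (v m) \<le> B" by auto
  have "norm (u z) \<le> B * norm z ^ n" if "1 \<le> norm z" for z
  proof -
    from that have "z \<noteq> 0" "norm (1 / z) \<le> 1" by (auto simp: norm_divide divide_le_eq)
    then show ?thesis
      using mult_left_mono[OF B[of "1/z"], of "norm z ^ n"] uv[of z]
      by (auto simp: norm_mult norm_power mult.commute)
  qed
  then have "u z = (\<Sum>k\<le>n. (deriv ^^ k) u 0 / fact k * z ^ k)" for z
    by (rule Liouville_polynomial[OF u])
  then show ?thesis by (intro exI[of _ "\<lambda>k. (deriv ^^ k) u 0 / fact k"]) simp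
qed

text \<open>The case \<open>n = 0\<close> of the Liouville argument; the value of \<open>v\<close>
  at its own origin, which the patching does not reach, follows by continuity.\<close>

lemma entire_both_charts_const:
  fixes u v :: "complex \<Rightarrow> complex"
  assumes u: "u holomorphic_on UNIV" and v: "v holomorphic_on UNIV"
    and uv: "\<And>z. z \<noteq> 0 \<Longrightarrow> u z = v (1 / z)"
  shows "u z = u 0" "v z = u 0"
proof -
  obtain c where c: "\<And>z. u z = (\<Sum>k\<le>0. c k * z ^ k)"
    using entire_pole_infinity_poly[OF u v, of 0] uv by auto
  then show *: "u z = u 0" for z by simp
  show "v z = u 0"
  proof (rule entire_eq_punctured[OF v holomorphic_on_const])
    fix z :: complex assume "z \<noteq> 0"
    then show "v z = u 0" using uv[of "1/z"] *[of "1/z"] by simp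
  qed
qed

text \<open>\<open>z ^ Suc n * u z\<close> is a global function, hence constant, and it vanishes at
  \<open>z = 0\<close>. In bundle terms, \<open>O(-n-1)\<close> has no nonzero sections.\<close>

lemma entire_zero_infinity_zero:
  fixes u v :: "complex \<Rightarrow> complex"
  assumes u: "u holomorphic_on UNIV" and v: "v holomorphic_on UNIV"
    and uv: "\<And>z. z \<noteq> 0 \<Longrightarrow> z ^ Suc n * u z = v (1 / z)"
  shows "u z = 0"
proof (rule entire_eq_punctured[OF u holomorphic_on_const])
  fix z :: complex assume "z \<noteq> 0"
  moreover have "z ^ Suc n * u z = 0 ^ Suc n * u 0"
    by (rule entire_both_charts_const(1)[OF _ v uv]) (use u in \<open>auto intro!: holomorphic_intros\<close>)
  ultimately show "u z = 0" by simp
qed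

lemma polyfun_coeff_eqD:
  fixes c d :: "nat \<Rightarrow> complex"
  assumes "\<And>z. (\<Sum>k\<le>n. c k * z ^ k) = (\<Sum>k\<le>n. d k * z ^ k)" "k \<le> n"
  shows "c k = d k"
  using polyfun_eq_coeffs[of c n d] assms by auto

section \<open>Indices 0 to 3 and the basic one-forms on \<open>M\<close>\<close>

text \<open>In the type \<open>4\<close> the numeral \<open>4\<close> equals \<open>0\<close>, which
  turns the indices 1 to 4 of \<open>forall_4\<close> into 0 to 3.\<close>

lemma all_4: "(\<forall>i::4. P i) \<longleftrightarrow> P 0 \<and> P 1 \<and> P 2 \<and> P 3"
proof -
  have "(4::4) = 0" by simp
  then show ?thesis using forall_4[of P] by metis
qed

lemma cases_4: obtains "i = (0::4)" | "i = 1" | "i = 2" | "i = 3"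
  using all_4[of "\<lambda>i. i = 0 \<or> i = 1 \<or> i = 2 \<or> i = 3"] by auto

lemma sum_UNIV_4: "sum g (UNIV :: 4 set) = g 0 + g 1 + g 2 + g 3"
proof -
  have "(4::4) = 0" by simp
  then have "sum g UNIV = g 1 + g 2 + g 3 + g 0" using sum_4[of g] by metis
  then show ?thesis by (simp add: ac_simps)
qed

text \<open>This is the one-form \<open>dS|\<close> on \<open>M\<close> at fixed \<lambda>.\<close>

definition S_form :: "complex \<Rightarrow> complex^4" where
  "S_form l = (\<chi> i. if i = 0 then 1 else if i = 1 then l else if i = 2 then l^2 else l^3)"

text \<open>The form \<open>dx_(k+1)\<close>. The shift makes it the coefficient of
  \<open>l ^ k\<close> in \<open>quad_form l\<close>, which is
  \<open>(dS| - dx_0) / l\<close>.\<close>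

definition E_form :: "nat \<Rightarrow> complex^4" where
  "E_form k = axis (of_nat (Suc k)) 1"

definition quad_form :: "complex \<Rightarrow> complex^4" where
  "quad_form l = (\<Sum>k\<le>2. l ^ k *s E_form k)"

lemma S_form_nth [simp]:
  "S_form l $ 0 = 1" "S_form l $ 1 = l" "S_form l $ 2 = l^2" "S_form l $ 3 = l^3"
  by (simp_all add: S_form_def)

lemma E_form_simps [simp]:
  "E_form 0 = axis 1 1" "E_form (Suc 0) = axis 2 1" "E_form 2 = axis 3 1"
  by (simp_all add: E_form_def)

lemma quad_form_nth [simp]:
  "quad_form l $ 0 = 0" "quad_form l $ 1 = 1" "quad_form l $ 2 = l" "quad_form l $ 3 = l^2"
  by (simp_all add: quad_form_def atMost_nat_numeral axis_def)

lemma S_form_eq: "S_form l = axis 0 1 + l *s quad_form l"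
  unfolding vec_eq_iff all_4 by (simp add: axis_def power2_eq_square power3_eq_cube)

lemma cubic_axis: "cubic (x + axis i t) l = cubic x l + t * S_form l $ i"
  by (cases i rule: cases_4) (simp_all add: cubic_def axis_def algebra_simps)

section \<open>Divided differences along a section\<close>

text \<open>The divided difference \<open>(h(S|) - h(x_0)) / l\<close>, obtained by synthetic
  division so that it is a polynomial in \<open>l\<close> with the right value at
  \<open>l = 0\<close>. For \<open>h = f\<close> it is minus the \<zeta>-coordinate of the section;
  for \<open>h = pderiv f\<close> it is the \<open>g\<close> in
  \<open>f'(S|) = \<gamma>_0 + l * g\<close>.\<close>

definition tail :: "complex poly \<Rightarrow> complex^4 \<Rightarrow> complex \<Rightarrow> complex" where
  "tail h x = poly (synthetic_div (pcompose h [:x $ 0, x $ 1, x $ 2, x $ 3:]) 0)"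

lemma poly_pcompose_cubic: "poly (pcompose h [:x $ 0, x $ 1, x $ 2, x $ 3:]) l = poly h (cubic x l)"
  by (simp add: poly_pcompose cubic_def algebra_simps power2_eq_square power3_eq_cube)

lemma poly_cubic_eq: "poly h (cubic x l) = poly h (x $ 0) + l * tail h x l"
proof -
  have "poly h (cubic x l) = poly ([:- 0, 1:] * synthetic_div (pcompose h [:x $ 0, x $ 1, x $ 2, x $ 3:]) 0
        + [:poly (pcompose h [:x $ 0, x $ 1, x $ 2, x $ 3:]) 0:]) l"
    unfolding synthetic_div_correct' by (simp add: poly_pcompose_cubic)
  then show ?thesis by (simp add: tail_def poly_pcompose_cubic cubic_def)
qed

lemma tail_nonzero: "l \<noteq> 0 \<Longrightarrow> tail h x l = (poly h (cubic x l) - poly h (x $ 0)) / l"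
  by (simp add: poly_cubic_eq field_simps)

lemma holomorphic_poly [holomorphic_intros]:
  "g holomorphic_on A \<Longrightarrow> (\<lambda>z. poly p (g z)) holomorphic_on A"
  by (induction p) (auto intro!: holomorphic_intros)

lemma holomorphic_tail [holomorphic_intros]: "tail h x holomorphic_on A"
  unfolding tail_def by (intro holomorphic_intros)

lemma holomorphic_cubic [holomorphic_intros]: "cubic x holomorphic_on A"
  unfolding cubic_def by (intro holomorphic_intros)

lemma cubic_0 [simp]: "cubic x 0 = x $ 0"
  by (simp add: cubic_def)

text \<open>Both sides are the derivative of \<open>poly h (cubic x l)\<close> at
  \<open>l = 0\<close>, computed once through \<open>poly_cubic_eq\<close> and once by the chain
  rule.\<close>

lemma tail_0: "tail h x 0 = poly (pderiv h) (x $ 0) * x $ 1"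
proof (rule DERIV_unique)
  have "(tail h x has_field_derivative deriv (tail h x) 0) (at 0)"
    by (rule holomorphic_derivI[OF holomorphic_tail open_UNIV]) simp
  then have "((\<lambda>l. poly h (x $ 0) + l * tail h x l) has_field_derivative tail h x 0) (at 0)"
    by (auto intro!: derivative_eq_intros)
  then show "((\<lambda>l. poly h (cubic x l)) has_field_derivative tail h x 0) (at 0)"
    by (simp add: poly_cubic_eq)
  have "(cubic x has_field_derivative x $ 1) (at 0)"
    unfolding cubic_def by (auto intro!: derivative_eq_intros)
  from DERIV_chain2[OF poly_DERIV this]
  show "((\<lambda>l. poly h (cubic x l)) has_field_derivative poly (pderiv h) (x $ 0) * x $ 1) (at 0)"
    by simp
qed

lemma mholo_cubic [mholo_intros]: "mholo W (\<lambda>x. cubic x l)"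
  unfolding cubic_def by (intro mholo_intros)

text \<open>For \<open>l \<noteq> 0\<close> the quotient formula shows holomorphy in
  \<open>x\<close>; at \<open>l = 0\<close> the closed form \<open>tail_0\<close> takes its
  place.\<close>

lemma mholo_tail [mholo_intros]: "mholo W (\<lambda>x. tail h x l)"
proof (cases "l = 0")
  case True
  then show ?thesis unfolding True tail_0 by (intro mholo_intros)
next
  case False
  then show ?thesis
    unfolding tail_nonzero[OF False]
    by (intro mholo_intros False)
qed

lemma DERIV_affine: "((\<lambda>t. a + t * b) has_field_derivative b) (at (t::complex))"
  by (auto intro!: derivative_eq_intros)

lemma DERIV_poly_affine:
  "((\<lambda>t. poly h (a + t * b)) has_field_derivative poly (pderiv h) a * b) (at (0::complex))"
  using DERIV_chain2[OF poly_DERIV[of h "a + 0 * b"] DERIV_affine[of a b 0]] by simp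

lemma pd_poly_nth0: "pd i (\<lambda>y. poly h (y $ 0)) x = poly (pderiv h) (x $ 0) * axis 0 1 $ i"
proof (rule pd_eqI)
  have "(x + axis i t) $ 0 = x $ 0 + t * axis 0 1 $ i" for t
    by (simp add: axis_def)
  then show "((\<lambda>t. poly h ((x + axis i t) $ 0)) has_field_derivative
      poly (pderiv h) (x $ 0) * axis 0 1 $ i) (at 0)"
    using DERIV_poly_affine[of h "x $ 0" "axis 0 1 $ i"] by simp
qed

lemma pd_cubic: "pd i (\<lambda>y. cubic y l) x = S_form l $ i"
  by (rule pd_eqI) (auto simp: cubic_axis intro!: derivative_eq_intros)

text \<open>Differentiating the divided difference gives
  \<open>(h'(S|) dS| - h'(x_0) dx_0) / l\<close>. Inserting
  \<open>h'(S|) = h'(x_0) + l * tail (pderiv h) x l\<close> and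
  \<open>dS| = dx_0 + l * quad_form l\<close> cancels the denominator. The point
  \<open>l = 0\<close> is treated through \<open>tail_0\<close>.\<close>

lemma DERIV_tail:
  "((\<lambda>t. tail h (x + axis i t) l) has_field_derivative
     poly (pderiv h) (x $ 0) * quad_form l $ i + tail (pderiv h) x l * S_form l $ i) (at 0)"
proof -
  have x0: "(x + axis i t) $ 0 = x $ 0 + t * axis 0 1 $ i" for t
    by (simp add: axis_def)
  show ?thesis
  proof (cases "l = 0")
    case True
    have x1: "(x + axis i t) $ 1 = x $ 1 + t * axis 1 1 $ i" for t
      by (simp add: axis_def)
    have "((\<lambda>t. poly (pderiv h) (x $ 0 + t * axis 0 1 $ i) * (x $ 1 + t * axis 1 1 $ i))
       has_field_derivative poly (pderiv (pderiv h)) (x $ 0) * axis 0 1 $ i * (x $ 1)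
         + poly (pderiv h) (x $ 0) * axis 1 1 $ i) (at 0)"
      using DERIV_mult[OF DERIV_poly_affine[of "pderiv h" "x $ 0" "axis 0 1 $ i"]
          DERIV_affine[of "x $ 1" "axis 1 1 $ i"]]
      by (simp add: algebra_simps)
    moreover have "quad_form 0 $ i = axis 1 1 $ i" "S_form 0 $ i = axis 0 1 $ i"
      by (cases i rule: cases_4; simp add: axis_def)+
    ultimately show ?thesis
      unfolding True tail_0 x0 x1 by (simp add: algebra_simps)
  next
    case False
    have "((\<lambda>t. (poly h (cubic x l + t * S_form l $ i) - poly h (x $ 0 + t * axis 0 1 $ i)) / l)
       has_field_derivative (poly (pderiv h) (cubic x l) * S_form l $ i
          - poly (pderiv h) (x $ 0) * axis 0 1 $ i) / l) (at 0)"
      by (intro DERIV_cdivide DERIV_diff DERIV_poly_affine)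
    moreover have "(poly (pderiv h) (cubic x l) * S_form l $ i
          - poly (pderiv h) (x $ 0) * axis 0 1 $ i) / l =
       poly (pderiv h) (x $ 0) * quad_form l $ i + tail (pderiv h) x l * S_form l $ i"
      using False by (simp add: poly_cubic_eq S_form_eq field_simps)
    ultimately show ?thesis
      unfolding tail_nonzero[OF False, of h] cubic_axis x0 by simp
  qed
qed

section \<open>The global sections\<close>

text \<open>The coordinate \<open>S\<close> in the second chart: \<open>m^3 * cubic x (1/m)\<close>
  with the denominators cleared.\<close>

definition rev_cubic :: "complex^4 \<Rightarrow> complex \<Rightarrow> complex" where
  "rev_cubic x m = x $ 0 * m^3 + x $ 1 * m^2 + x $ 2 * m + x $ 3"

lemma holomorphic_rev_cubic [holomorphic_intros]: "rev_cubic x holomorphic_on A"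
  unfolding rev_cubic_def by (intro holomorphic_intros)

text \<open>The patched coordinate \<open>l * \<zeta> + f(S|)\<close> must be constant. Its value at
  \<open>l = 0\<close> is \<open>f(x_0)\<close>, and solving for \<zeta> gives
  \<open>- tail f x l\<close>.\<close>

definition explicit_curve ::
  "complex poly \<Rightarrow> complex^4 \<Rightarrow> (complex \<Rightarrow> complex^2) \<times> (complex \<Rightarrow> complex^2)" where
  "explicit_curve f x =
     (\<lambda>l. vector [- tail f x l, cubic x l], \<lambda>m. vector [poly f (x $ 0), rev_cubic x m])"

lemma rev_cubic_inverse: "z \<noteq> 0 \<Longrightarrow> rev_cubic x (1 / z) = cubic x z / z ^ 3"
  by (simp add: rev_cubic_def cubic_def field_simps power2_eq_square power3_eq_cube)

lemma powi_minus_3: "z powi (-3) = 1 / (z::complex) ^ 3"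
  by (simp add: power_int_minus inverse_eq_divide)

lemma explicit_curve_section: "explicit_curve f x \<in> sections f"
proof -
  have "(\<lambda>z. - tail f x z) holomorphic_on UNIV" "(\<lambda>z. cubic x z) holomorphic_on UNIV"
    "(\<lambda>m. rev_cubic x m) holomorphic_on UNIV"
    by (intro holomorphic_intros)+
  then show ?thesis
    by (simp add: sections_def explicit_curve_def forall_2 patch_def vec_eq_iff
        rev_cubic_inverse powi_minus_3 poly_cubic_eq[of f x])
qed

lemma explicit_curve_coords: "has_coords (explicit_curve f x) x"
  by (simp add: has_coords_def explicit_curve_def)

lemma cubic_inject:
  assumes "\<And>l. cubic x l = cubic y l"
  shows "x = y"
proof -
  have "[:x $ 0, x $ 1, x $ 2, x $ 3:] = [:y $ 0, y $ 1, y $ 2, y $ 3:]"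
    by (rule poly_ext) (use assms in \<open>simp add: cubic_def algebra_simps power2_eq_square power3_eq_cube\<close>)
  then show ?thesis by (simp add: vec_eq_iff all_4)
qed

lemma section_unique:
  assumes "p \<in> sections f" "has_coords p x"
  shows "p = explicit_curve f x"
proof -
  obtain w v where p: "p = (w, v)" by fastforce
  have hol: "(\<lambda>z. w z $ \<mu>) holomorphic_on UNIV" "(\<lambda>z. v z $ \<mu>) holomorphic_on UNIV" for \<mu>
    using assms(1) by (auto simp: sections_def p)
  have pat: "v (1 / z) = patch f z (w z)" if "z \<noteq> 0" for z
    using assms(1) that by (auto simp: sections_def p)
  have w2: "w l $ 2 = cubic x l" for l
    using assms(2) by (simp add: has_coords_def p)
  \<comment> \<open>The first patched coordinate is entire in \<open>z\<close> and, by
    \<open>eq\<close>, also in \<open>1/z\<close>, so it always equals its value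
    \<open>f(x_0)\<close> at \<open>z = 0\<close>.\<close>
  have u: "(\<lambda>z. z * w z $ 1 + poly f (cubic x z)) holomorphic_on UNIV"
    by (intro holomorphic_intros hol)
  have eq: "z * w z $ 1 + poly f (cubic x z) = v (1 / z) $ 1" if "z \<noteq> 0" for z
    using pat[OF that] by (simp add: patch_def w2)
  have "v z $ 1 = poly f (x $ 0)" for z
    using entire_both_charts_const(2)[OF u hol(2) eq] by simp
  \<comment> \<open>Off \<open>z = 0\<close> this constant determines \<zeta>; continuity fills in
    the origin.\<close>
  moreover have "w z $ 1 = - tail f x z" for z
  proof (rule entire_eq_punctured[OF hol(1)])
    fix z :: complex assume "z \<noteq> 0"
    then show "w z $ 1 = - tail f x z"
      using entire_both_charts_const(1)[OF u hol(2) eq, of z] poly_cubic_eq[of f x z]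
      by (simp add: eq_neg_iff_add_eq_0 flip: distrib_left)
  qed (intro holomorphic_intros)
  moreover have "v z $ 2 = rev_cubic x z" for z
  proof (rule entire_eq_punctured[OF hol(2)])
    fix z :: complex assume "z \<noteq> 0"
    then show "v z $ 2 = rev_cubic x z"
      using pat[of "1/z"] rev_cubic_inverse[of "1/z" x]
      by (simp add: patch_def w2 powi_minus_3)
  qed (intro holomorphic_intros)
  ultimately show ?thesis
    by (auto simp: p explicit_curve_def fun_eq_iff vec_eq_iff forall_2 w2)
qed

lemma curve_eq: "curve f x = explicit_curve f x"
  unfolding curve_def
  by (rule the_equality) (auto intro: section_unique explicit_curve_section explicit_curve_coords)

lemma wU_nth [simp]: "wU f x l $ 1 = - tail f x l" "wU f x l $ 2 = cubic x l"
  by (simp_all add: wU_def curve_eq explicit_curve_def)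

lemma wV_nth [simp]: "wV f x m $ 1 = poly f (x $ 0)" "wV f x m $ 2 = rev_cubic x m"
  by (simp_all add: wV_def curve_eq explicit_curve_def)

text \<open>The \<open>S\<close>-component is a global section of \<open>O(3)\<close>, hence a cubic
  polynomial, and its four coefficients are the coordinates.\<close>

lemma section_has_coords:
  assumes "p \<in> sections f"
  shows "\<exists>!x. has_coords p x"
proof -
  obtain w v where p: "p = (w, v)" by fastforce
  have hol: "(\<lambda>z. w z $ 2) holomorphic_on UNIV" "(\<lambda>z. v z $ 2) holomorphic_on UNIV"
    using assms by (auto simp: sections_def p)
  have eq: "w z $ 2 = z ^ 3 * v (1 / z) $ 2" if "z \<noteq> 0" for z
    using assms that by (auto simp: sections_def p patch_def powi_minus_3)
  obtain c where c: "\<And>z. w z $ 2 = (\<Sum>k\<le>3. c k * z ^ k)"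
    using entire_pole_infinity_poly[OF hol eq] by blast
  have "has_coords p (\<chi> i. if i = 0 then c 0 else if i = 1 then c 1 else if i = 2 then c 2 else c 3)"
    by (simp add: has_coords_def p c cubic_def atMost_nat_numeral)
  then show ?thesis
    by (auto simp: has_coords_def intro!: cubic_inject)
qed

lemma dwU_nth:
  "dwU f x l $ 1 = - (poly (pderiv f) (x $ 0) *s quad_form l + tail (pderiv f) x l *s S_form l)"
  "dwU f x l $ 2 = S_form l"
proof -
  have "pd i (\<lambda>y. - tail f y l) x =
      - (poly (pderiv f) (x $ 0) * quad_form l $ i + tail (pderiv f) x l * S_form l $ i)" for i
    by (intro pd_eqI DERIV_minus DERIV_tail)
  then show "dwU f x l $ 1 = - (poly (pderiv f) (x $ 0) *s quad_form l + tail (pderiv f) x l *s S_form l)"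
    by (simp add: dwU_def vec_eq_iff)
  show "dwU f x l $ 2 = S_form l"
    by (simp add: dwU_def vec_eq_iff pd_cubic)
qed

section \<open>Splittings of the normal bundle\<close>

definition mat2 :: "'a \<Rightarrow> 'a \<Rightarrow> 'a \<Rightarrow> 'a \<Rightarrow> ('a::zero)^2^2" where
  "mat2 a b c d = vector [vector [a, b], vector [c, d]]"

lemma mat2_nth [simp]:
  "mat2 a b c d $ 1 $ 1 = a" "mat2 a b c d $ 1 $ 2 = b"
  "mat2 a b c d $ 2 $ 1 = c" "mat2 a b c d $ 2 $ 2 = d"
  by (simp_all add: mat2_def)

lemma diag2_nth [simp]:
  "diag2 a b $ 1 $ 1 = a" "diag2 a b $ 1 $ 2 = 0" "diag2 a b $ 2 $ 1 = 0" "diag2 a b $ 2 $ 2 = b"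
  by (simp_all add: diag2_def)

lemma matrix_mult_2_nth:
  "(A ** B) $ i $ j = A $ i $ 1 * B $ 1 $ j + A $ i $ 2 * B $ 2 $ (j::'n)"
  for A :: "complex^2^'m" and B :: "complex^'n^2"
  by (simp add: matrix_matrix_mult_def sum_2)

lemma matrix_2_eq_iff:
  "A = B \<longleftrightarrow> A $ 1 $ 1 = B $ 1 $ 1 \<and> A $ 1 $ 2 = B $ 1 $ 2 \<and> A $ 2 $ 1 = B $ 2 $ 1 \<and> A $ 2 $ 2 = B $ 2 $ 2"
  for A B :: "'a^2^2"
  by (auto simp: vec_eq_iff forall_2)

lemma mat_1_2_nth:
  "(mat 1 :: complex^2^2) $ 1 $ 1 = 1" "(mat 1 :: complex^2^2) $ 1 $ 2 = 0"
  "(mat 1 :: complex^2^2) $ 2 $ 1 = 0" "(mat 1 :: complex^2^2) $ 2 $ 2 = 1"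
  by (simp_all add: mat_def)

lemma matrix_inv_unique:
  fixes A B :: "complex^'n^'n"
  assumes "A ** B = mat 1"
  shows "matrix_inv A = B"
proof -
  have "B ** A = mat 1" using assms matrix_left_right_inverse by blast
  then have "invertible A" using assms unfolding invertible_def by blast
  then have "matrix_inv A ** A = mat 1"
    unfolding matrix_inv_def invertible_def by (rule someI2_ex) simp
  then show ?thesis
    by (metis assms matrix_mul_assoc matrix_mul_lid matrix_mul_rid)
qed

lemma matrix_inv_mult:
  fixes A :: "complex^'n^'n"
  assumes "invertible A"
  shows "A ** matrix_inv A = mat 1" "matrix_inv A ** A = mat 1"
  using assms unfolding matrix_inv_def invertible_def by (rule someI2_ex; simp)+

lemma matrix_inv_2:
  fixes A :: "complex^2^2"
  assumes "det A \<noteq> 0"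
  shows "matrix_inv A = mat2 (A $ 2 $ 2 / det A) (- (A $ 1 $ 2) / det A)
    (- (A $ 2 $ 1) / det A) (A $ 1 $ 1 / det A)"
proof (rule matrix_inv_unique)
  have "A $ 1 $ 1 * A $ 2 $ 2 - A $ 1 $ 2 * A $ 2 $ 1 = det A"
    "A $ 2 $ 2 * A $ 1 $ 1 - A $ 2 $ 1 * A $ 1 $ 2 = det A"
    by (simp_all add: det_2)
  then show "A ** mat2 (A $ 2 $ 2 / det A) (- (A $ 1 $ 2) / det A)
      (- (A $ 2 $ 1) / det A) (A $ 1 $ 1 / det A) = mat 1"
    using assms by (simp add: matrix_2_eq_iff matrix_mult_2_nth mat_1_2_nth flip: diff_divide_distrib)
qed

section \<open>The normal patching and the comparison of splittings\<close>

lemma normal_patch_eq: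
  "normal_patch f x l = mat2 l (poly (pderiv f) (cubic x l)) 0 (l powi (-3))"
proof -
  have 1: "pd \<nu> (\<lambda>w::complex^2. l * w $ 1 + poly f (w $ 2)) w0
      = l * axis 1 1 $ \<nu> + poly (pderiv f) (w0 $ 2) * axis 2 1 $ \<nu>" for \<nu> w0
  proof (rule pd_eqI)
    have "(w0 + axis \<nu> t) $ 1 = w0 $ 1 + t * axis 1 1 $ \<nu>"
      "(w0 + axis \<nu> t) $ 2 = w0 $ 2 + t * axis 2 1 $ \<nu>" for t
      by (simp_all add: axis_def)
    then show "((\<lambda>t. l * (w0 + axis \<nu> t) $ 1 + poly f ((w0 + axis \<nu> t) $ 2)) has_field_derivative
        l * axis 1 1 $ \<nu> + poly (pderiv f) (w0 $ 2) * axis 2 1 $ \<nu>) (at 0)"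
      by (simp only:) (intro DERIV_add DERIV_cmult DERIV_affine DERIV_poly_affine)
  qed
  have 2: "pd \<nu> (\<lambda>w::complex^2. l powi (-3) * w $ 2) w0 = l powi (-3) * axis 2 1 $ \<nu>" for \<nu> w0
  proof (rule pd_eqI)
    have "(w0 + axis \<nu> t) $ 2 = w0 $ 2 + t * axis 2 1 $ \<nu>" for t
      by (simp add: axis_def)
    then show "((\<lambda>t. l powi (-3) * (w0 + axis \<nu> t) $ 2) has_field_derivative
        l powi (-3) * axis 2 1 $ \<nu>) (at 0)"
      by (simp only:) (intro DERIV_cmult DERIV_affine)
  qed
  show ?thesis
    by (simp add: matrix_2_eq_iff normal_patch_def patch_def 1 2) (simp add: axis_def)
qed

text \<open>The factorisation is required with \<open>H z\<close> moved to the left-hand side, so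
  that explicit frames can be verified without inverting them.\<close>

lemma splittingI:
  assumes "\<And>i j. (\<lambda>z. H z $ i $ j) holomorphic_on UNIV" "\<And>i j. (\<lambda>z. H' z $ i $ j) holomorphic_on UNIV"
    and "\<And>z. invertible (H z)" "\<And>z. invertible (H' z)"
    and "\<And>z. z \<noteq> 0 \<Longrightarrow> F z ** H z = H' (1/z) ** diag2 (z powi (-a)) (z powi (-b))"
  shows "splitting F a b H H'"
  unfolding splitting_def
  using assms matrix_inv_mult(1)[OF assms(3)]
  by (metis matrix_mul_assoc matrix_mul_rid)

lemma splittingD:
  assumes "splitting F a b H H'"
  shows "(\<lambda>z. H z $ i $ j) holomorphic_on UNIV" "(\<lambda>z. H' z $ i $ j) holomorphic_on UNIV"
    and "invertible (H z)" "invertible (H' z)"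
    and "z \<noteq> 0 \<Longrightarrow> F z ** H z = H' (1/z) ** diag2 (z powi (-a)) (z powi (-b))"
  using assms unfolding splitting_def
  by (auto simp: matrix_mul_assoc[symmetric] matrix_inv_mult)

text \<open>The formula of \<open>matrix_inv_2\<close> divides only by the determinant, which has no
  zeros.\<close>

lemma holomorphic_inv_mult:
  fixes H K :: "complex \<Rightarrow> complex^2^2"
  assumes "\<And>i j. (\<lambda>z. H z $ i $ j) holomorphic_on UNIV" "\<And>i j. (\<lambda>z. K z $ i $ j) holomorphic_on UNIV"
    and "\<And>z. invertible (H z)"
  shows "(\<lambda>z. (matrix_inv (H z) ** K z) $ i $ j) holomorphic_on UNIV"
proof -
  have d: "det (H z) \<noteq> 0" for z using assms(3) invertible_det_nz by blast
  then have d': "H z $ 1 $ 1 * H z $ 2 $ 2 - H z $ 1 $ 2 * H z $ 2 $ 1 \<noteq> 0" for z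
    by (simp add: det_2)
  have "(\<lambda>z. matrix_inv (H z) $ i $ j) holomorphic_on UNIV" for i j
    using exhaust_2[of i] exhaust_2[of j] assms(1) d'
    by (auto simp: matrix_inv_2[OF d] det_2 intro!: holomorphic_intros)
  then show ?thesis
    unfolding matrix_mult_2_nth by (intro holomorphic_intros assms(2))
qed

text \<open>In the two charts \<open>G = H^-1 K\<close> and \<open>G' = H'^-1 K'\<close> represent
  one isomorphism from \<open>O(c) + O(d)\<close> to \<open>O(a) + O(b)\<close>. Uniqueness
  questions about splittings thereby reduce to its four entries.\<close>

lemma splitting_transition:
  assumes H: "splitting F a b H H'" and K: "splitting F c d K K'"
  obtains G G' where
    "\<And>i j. (\<lambda>z. G z $ i $ j) holomorphic_on UNIV" "\<And>i j. (\<lambda>z. G' z $ i $ j) holomorphic_on UNIV"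
    "\<And>z. invertible (G z)" "\<And>z. K z = H z ** G z" "\<And>z. K' z = H' z ** G' z"
    "\<And>z. z \<noteq> 0 \<Longrightarrow> diag2 (z powi (-a)) (z powi (-b)) ** G z = G' (1/z) ** diag2 (z powi (-c)) (z powi (-d))"
proof (rule that[of "\<lambda>z. matrix_inv (H z) ** K z" "\<lambda>z. matrix_inv (H' z) ** K' z"])
  note Hi = matrix_inv_mult[OF splittingD(3)[OF H]] matrix_inv_mult[OF splittingD(4)[OF H]]
  show G: "K z = H z ** (matrix_inv (H z) ** K z)" "K' z = H' z ** (matrix_inv (H' z) ** K' z)" for z
    by (simp_all add: matrix_mul_assoc Hi)
  show "invertible (matrix_inv (H z) ** K z)" for z
    using Hi[of z] splittingD(3)[OF K] by (intro invertible_mult) (auto simp: invertible_def)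
  show "(\<lambda>z. (matrix_inv (H z) ** K z) $ i $ j) holomorphic_on UNIV"
    "(\<lambda>z. (matrix_inv (H' z) ** K' z) $ i $ j) holomorphic_on UNIV" for i j
    by (intro holomorphic_inv_mult splittingD[OF H] splittingD[OF K])+
  show "diag2 (z powi (-a)) (z powi (-b)) ** (matrix_inv (H z) ** K z) =
      matrix_inv (H' (1/z)) ** K' (1/z) ** diag2 (z powi (-c)) (z powi (-d))" if "z \<noteq> 0" for z
  proof -
    have "H' (1/z) ** diag2 (z powi (-a)) (z powi (-b)) ** (matrix_inv (H z) ** K z)
        = F z ** (H z ** (matrix_inv (H z) ** K z))"
      using splittingD(5)[OF H that] by (simp add: matrix_mul_assoc)
    also have "\<dots> = K' (1/z) ** diag2 (z powi (-c)) (z powi (-d))"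
      using splittingD(5)[OF K that] by (simp flip: G)
    finally have "matrix_inv (H' (1/z)) ** (H' (1/z) ** diag2 (z powi (-a)) (z powi (-b)) ** (matrix_inv (H z) ** K z))
        = matrix_inv (H' (1/z)) ** (K' (1/z) ** diag2 (z powi (-c)) (z powi (-d)))"
      by simp
    then show ?thesis by (simp add: matrix_mul_assoc Hi)
  qed
qed

text \<open>The second column of the transition maps \<open>O(3)\<close> to \<open>O + O(2)\<close>.
  Its entries are sections of \<open>O(-3)\<close> and \<open>O(-1)\<close>, so the column vanishes
  and the transition cannot be invertible.\<close>

lemma splitting_types_disjoint:
  assumes "splitting F 0 2 H H'" "splitting F (-1) 3 K K'"
  shows False
proof -
  obtain G G' where hol: "\<And>i j. (\<lambda>z. G z $ i $ j) holomorphic_on UNIV"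
    "\<And>i j. (\<lambda>z. G' z $ i $ j) holomorphic_on UNIV"
    and inv: "\<And>z. invertible (G z)"
    and eq: "\<And>z. z \<noteq> 0 \<Longrightarrow> diag2 (z powi (-0)) (z powi (-2)) ** G z =
        G' (1/z) ** diag2 (z powi (-(-1))) (z powi (-3))"
    using splitting_transition[OF assms] by metis
  have "G 0 $ 1 $ 2 = 0"
  proof (rule entire_zero_infinity_zero[OF hol(1) hol(2), of 2])
    fix z :: complex assume z: "z \<noteq> 0"
    from arg_cong[OF eq[OF z], of "\<lambda>A. A $ 1 $ 2"]
    show "z ^ Suc 2 * G z $ 1 $ 2 = G' (1/z) $ 1 $ 2"
      using z by (simp add: matrix_mult_2_nth powi_minus_3 field_simps power3_eq_cube)
  qed
  moreover have "G 0 $ 2 $ 2 = 0"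
  proof (rule entire_zero_infinity_zero[OF hol(1) hol(2), of 0])
    fix z :: complex assume z: "z \<noteq> 0"
    from arg_cong[OF eq[OF z], of "\<lambda>A. A $ 2 $ 2"]
    show "z ^ Suc 0 * G z $ 2 $ 2 = G' (1/z) $ 2 $ 2"
      using z by (simp add: matrix_mult_2_nth powi_minus_3 power_int_minus field_simps power2_eq_square power3_eq_cube)
  qed
  ultimately have "det (G 0) = 0" by (simp add: det_2)
  then show False using inv[of 0] invertible_det_nz by blast
qed

section \<open>Explicit splittings and the two normal types\<close>

text \<open>The first row of the normal patching is \<open>(z, c + z * g)\<close>. The second column
  here is \<open>(- c - g * z, z)\<close>, which that row annihilates; the first column solves the
  Bezout equation \<open>z * a + (c + z * g) * b = 1\<close> with \<open>b = 1 / c\<close>.\<close>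

definition frame_U :: "complex poly \<Rightarrow> complex^4 \<Rightarrow> complex \<Rightarrow> complex^2^2" where
  "frame_U f x z =
     (let c = poly (pderiv f) (x $ 0); g = tail (pderiv f) x z in mat2 (- g / c) (- c - g * z) (1 / c) z)"

text \<open>The lower triangular factor left over from the product with \<open>frame_U\<close>; its
  off-diagonal entry is \<open>z powi (-3) / c\<close> written in \<open>m = 1/z\<close>.\<close>

definition frame_V :: "complex poly \<Rightarrow> complex^4 \<Rightarrow> complex \<Rightarrow> complex^2^2" where
  "frame_V f x m = mat2 1 0 (m ^ 3 / poly (pderiv f) (x $ 0)) 1"

lemma det_frame_U: "poly (pderiv f) (x $ 0) \<noteq> 0 \<Longrightarrow> det (frame_U f x z) = 1"
  by (simp add: frame_U_def Let_def det_2 field_simps)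

lemma det_frame_V: "det (frame_V f x z) = 1"
  by (simp add: frame_V_def det_2)

lemma splitting_frame:
  assumes "poly (pderiv f) (x $ 0) \<noteq> 0"
  shows "splitting (normal_patch f x) 0 2 (frame_U f x) (frame_V f x)"
proof (rule splittingI)
  have "(\<lambda>z. tail (pderiv f) x z) holomorphic_on UNIV"
    by (intro holomorphic_intros)
  then show "(\<lambda>z. frame_U f x z $ i $ j) holomorphic_on UNIV" for i j
    using exhaust_2[of i] exhaust_2[of j] assms
    by (auto simp: frame_U_def Let_def intro!: holomorphic_intros)
  show "(\<lambda>z. frame_V f x z $ i $ j) holomorphic_on UNIV" for i j
    using exhaust_2[of i] exhaust_2[of j] assms
    by (auto simp: frame_V_def intro!: holomorphic_intros)
  show "invertible (frame_U f x z)" "invertible (frame_V f x z)" for z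
    by (simp_all add: invertible_det_nz det_frame_U[OF assms] det_frame_V)
  show "normal_patch f x z ** frame_U f x z =
      frame_V f x (1/z) ** diag2 (z powi (-0)) (z powi (-2))" if "z \<noteq> 0" for z
    using that assms
    by (simp add: normal_patch_eq frame_U_def frame_V_def Let_def matrix_2_eq_iff matrix_mult_2_nth
        poly_cubic_eq[of "pderiv f"] powi_minus_3 power_int_minus field_simps power2_eq_square power3_eq_cube)
qed

text \<open>Here \<open>f'(S|) = z * g\<close>, so subtracting \<open>g\<close> times the first
  column of the patching from the second makes it diagonal.\<close>

lemma splitting_jump:
  assumes "poly (pderiv f) (x $ 0) = 0"
  shows "splitting (normal_patch f x) (-1) 3 (\<lambda>z. mat2 1 (- tail (pderiv f) x z) 0 1) (\<lambda>z. mat2 1 0 0 1)"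
proof (rule splittingI)
  have "(\<lambda>z. tail (pderiv f) x z) holomorphic_on UNIV"
    by (intro holomorphic_intros)
  then show "(\<lambda>z. mat2 1 (- tail (pderiv f) x z) 0 1 $ i $ j) holomorphic_on UNIV" for i j
    using exhaust_2[of i] exhaust_2[of j] by (auto intro!: holomorphic_intros)
  show "normal_patch f x z ** mat2 1 (- tail (pderiv f) x z) 0 1 =
      mat2 1 0 0 1 ** diag2 (z powi (-(-1))) (z powi (-3))" for z
    using assms by (simp add: normal_patch_eq matrix_2_eq_iff matrix_mult_2_nth poly_cubic_eq[of "pderiv f"])
qed (auto simp: invertible_det_nz det_2)

text \<open>Every point carries one of the two explicit splittings, according to whether
  \<open>\<gamma>_0\<close> vanishes, and the two types exclude each other.\<close>

lemma normal_type_0_2: "normal_type f 0 2 = {x. poly (pderiv f) (x $ 0) \<noteq> 0}"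
  using splitting_frame splitting_jump splitting_types_disjoint unfolding normal_type_def by blast

lemma normal_type_jump: "normal_type f (-1) 3 = {x. poly (pderiv f) (x $ 0) = 0}"
  using splitting_frame splitting_jump splitting_types_disjoint unfolding normal_type_def by blast

section \<open>Frames, clock and spatial metric\<close>

lemma matrix_mult_2_row: "(A ** B) $ i = A $ i $ 1 *s B $ 1 + A $ i $ 2 *s B $ 2"
  for A :: "complex^2^'m" and B :: "complex^'n^2"
  by (simp add: vec_eq_iff matrix_mult_2_nth)

lemma frame_formsI:
  assumes "\<And>l. invertible (H l)"
    and "\<And>l. H l $ 1 $ 1 *s \<theta> + H l $ 1 $ 2 *s (\<Sum>k\<le>2. l ^ k *s e k) = dwU f x l $ 1"
    and "\<And>l. H l $ 2 $ 1 *s \<theta> + H l $ 2 $ 2 *s (\<Sum>k\<le>2. l ^ k *s e k) = dwU f x l $ 2"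
  shows "frame_forms f x H \<theta> e"
  unfolding frame_forms_def
proof
  fix l
  have "dwU f x l = H l ** vector [\<theta>, \<Sum>k\<le>2. l ^ k *s e k]"
    by (simp add: vec_eq_iff[where 'b=2] forall_2 matrix_mult_2_row assms(2,3))
  then have "matrix_inv (H l) ** dwU f x l = vector [\<theta>, \<Sum>k\<le>2. l ^ k *s e k]"
    by (simp add: matrix_mul_assoc matrix_inv_mult[OF assms(1)])
  then show "(matrix_inv (H l) ** dwU f x l) $ 1 = \<theta> \<and>
          (matrix_inv (H l) ** dwU f x l) $ 2 = (\<Sum>k\<le>2. l^k *s e k)"
    by simp
qed

lemma frame_U_forms:
  assumes "poly (pderiv f) (x $ 0) \<noteq> 0"
  shows "frame_U f x l $ 1 $ 1 *s (poly (pderiv f) (x $ 0) *s axis 0 1)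
      + frame_U f x l $ 1 $ 2 *s quad_form l = dwU f x l $ 1"
    and "frame_U f x l $ 2 $ 1 *s (poly (pderiv f) (x $ 0) *s axis 0 1)
      + frame_U f x l $ 2 $ 2 *s quad_form l = dwU f x l $ 2"
  using assms
  by (simp_all add: vec_eq_iff dwU_nth frame_U_def Let_def S_form_eq algebra_simps)

lemma frame_forms_frame_U:
  assumes "poly (pderiv f) (x $ 0) \<noteq> 0"
  shows "frame_forms f x (frame_U f x) (poly (pderiv f) (x $ 0) *s axis 0 1) E_form"
  using frame_U_forms[OF assms] splittingD(3)[OF splitting_frame[OF assms]]
  by (intro frame_formsI) (simp_all add: quad_form_def)

lemma frame_forms_unique:
  assumes "frame_forms f x H \<theta> e" "frame_forms f x H \<theta>' e'"
  shows "\<theta> = \<theta>'" "k \<le> 2 \<Longrightarrow> e k = e' k"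
proof -
  show "\<theta> = \<theta>'" using assms unfolding frame_forms_def by metis
  have "(\<Sum>k\<le>2. l ^ k *s e k) = (\<Sum>k\<le>2. l ^ k *s e' k)" for l
    using assms unfolding frame_forms_def by metis
  then have "(\<Sum>k\<le>2. e k $ i * l ^ k) = (\<Sum>k\<le>2. e' k $ i * l ^ k)" for l i
    by (simp add: vec_eq_iff mult.commute)
  then show "e k = e' k" if "k \<le> 2"
    using that polyfun_coeff_eqD[of "\<lambda>k. e k $ i" 2 "\<lambda>k. e' k $ i" k for i] by (auto simp: vec_eq_iff)
qed

text \<open>
  The transition \<open>G\<close> to the explicit frame is lower triangular with constant diagonal, and its diagonal
  can be read off from \<open>K'\<close> at \<open>1/\<lambda> = 0\<close>, where the explicit \<open>H'\<close> is the identity.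
\<close>

lemma frame_of_splitting:
  assumes c: "poly (pderiv f) (x $ 0) \<noteq> 0"
    and K: "splitting (normal_patch f x) 0 2 K K'"
  shows "K' 0 $ 1 $ 1 \<noteq> 0" "K' 0 $ 2 $ 2 \<noteq> 0"
    and "det (K z) = K' 0 $ 1 $ 1 * K' 0 $ 2 $ 2"
    and "\<exists>\<delta>. frame_forms f x K ((poly (pderiv f) (x $ 0) / K' 0 $ 1 $ 1) *s axis 0 1)
           (\<lambda>k. (1 / K' 0 $ 2 $ 2) *s E_form k + \<delta> k *s axis 0 1)"
proof -
  obtain G G' where hol: "\<And>i j. (\<lambda>z. G z $ i $ j) holomorphic_on UNIV"
    "\<And>i j. (\<lambda>z. G' z $ i $ j) holomorphic_on UNIV"
    and inv: "\<And>z. invertible (G z)"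
    and KG: "\<And>z. K z = frame_U f x z ** G z" "\<And>z. K' z = frame_V f x z ** G' z"
    and eq: "\<And>z. z \<noteq> 0 \<Longrightarrow> diag2 (z powi (-0)) (z powi (-2)) ** G z =
        G' (1/z) ** diag2 (z powi (-0)) (z powi (-2))"
    using splitting_transition[OF splitting_frame[OF c] K] by metis
  have G11: "G z $ 1 $ 1 = G 0 $ 1 $ 1" "G' z $ 1 $ 1 = G 0 $ 1 $ 1" for z
  proof -
    have "G z $ 1 $ 1 = G' (1/z) $ 1 $ 1" if "z \<noteq> 0" for z
      using arg_cong[OF eq[OF that], of "\<lambda>A. A $ 1 $ 1"] by (simp add: matrix_mult_2_nth)
    then show "G z $ 1 $ 1 = G 0 $ 1 $ 1" "G' z $ 1 $ 1 = G 0 $ 1 $ 1"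
      using entire_both_charts_const[OF hol(1) hol(2)] by blast+
  qed
  have G22: "G z $ 2 $ 2 = G 0 $ 2 $ 2" "G' z $ 2 $ 2 = G 0 $ 2 $ 2" for z
  proof -
    have "G z $ 2 $ 2 = G' (1/z) $ 2 $ 2" if "z \<noteq> 0" for z
      using arg_cong[OF eq[OF that], of "\<lambda>A. A $ 2 $ 2"] that by (simp add: matrix_mult_2_nth)
    then show "G z $ 2 $ 2 = G 0 $ 2 $ 2" "G' z $ 2 $ 2 = G 0 $ 2 $ 2"
      using entire_both_charts_const[OF hol(1) hol(2)] by blast+
  qed
  \<comment> \<open>This entry maps \<open>O(2)\<close> to \<open>O\<close>, so it is a section of
    \<open>O(-2)\<close>.\<close>
  have G12: "G z $ 1 $ 2 = 0" for z
  proof (rule entire_zero_infinity_zero[OF hol(1) hol(2), of 1])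
    fix z :: complex assume z: "z \<noteq> 0"
    from arg_cong[OF eq[OF z], of "\<lambda>A. A $ 1 $ 2"]
    show "z ^ Suc 1 * G z $ 1 $ 2 = G' (1/z) $ 1 $ 2"
      using z by (simp add: matrix_mult_2_nth power_int_minus field_simps power2_eq_square)
  qed
  \<comment> \<open>This entry maps \<open>O\<close> to \<open>O(2)\<close>, so it is a quadratic
    polynomial. It is the source of the multiples of \<open>dx_0\<close> in the spatial
    forms.\<close>
  have "G z $ 2 $ 1 = z ^ 2 * G' (1/z) $ 2 $ 1" if "z \<noteq> 0" for z
    using arg_cong[OF eq[OF that], of "\<lambda>A. A $ 2 $ 1"] that
    by (simp add: matrix_mult_2_nth power_int_minus field_simps)
  then obtain s where s: "\<And>z. G z $ 2 $ 1 = (\<Sum>k\<le>2. s k * z ^ k)"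
    using entire_pole_infinity_poly[OF hol(1) hol(2)] by blast
  have p: "K' 0 $ 1 $ 1 = G 0 $ 1 $ 1" and r: "K' 0 $ 2 $ 2 = G 0 $ 2 $ 2"
    using G11(2)[of 0] G22(2)[of 0] by (simp_all add: KG frame_V_def matrix_mult_2_nth)
  have det_G: "det (G z) = G 0 $ 1 $ 1 * G 0 $ 2 $ 2" for z
    using G11(1)[of z] G22(1)[of z] G12[of z] by (simp add: det_2)
  have "det (G 0) \<noteq> 0" using inv invertible_det_nz by blast
  then have nz: "G 0 $ 1 $ 1 \<noteq> 0" "G 0 $ 2 $ 2 \<noteq> 0" by (auto simp: det_G)
  then show "K' 0 $ 1 $ 1 \<noteq> 0" "K' 0 $ 2 $ 2 \<noteq> 0" by (simp_all add: p r)
  show "det (K z) = K' 0 $ 1 $ 1 * K' 0 $ 2 $ 2"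
    by (simp add: KG(1) p r det_mul det_frame_U[OF c] det_G)
  define P R C where "P = G 0 $ 1 $ 1" and "R = G 0 $ 2 $ 2" and "C = poly (pderiv f) (x $ 0)"
  \<comment> \<open>Forward substitution in \<open>G (\<theta>, e) = (C dx_0, quad_form)\<close>:
    first \<open>P \<theta> = C dx_0\<close>, then \<open>R e = quad_form - G21 \<theta>\<close>,
    taken coefficientwise in \<open>l\<close>.\<close>
  define e where "e k = (1 / R) *s E_form k + (- s k * C / (P * R)) *s axis 0 1" for k
  have sum_e: "(\<Sum>k\<le>2. l ^ k *s e k) = (1 / R) *s quad_form l - (G l $ 2 $ 1 * C / (P * R)) *s axis 0 1" for l
    by (simp add: vec_eq_iff e_def quad_form_def s atMost_nat_numeral algebra_simps
        add_divide_distrib diff_divide_distrib)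
  have "frame_forms f x K ((C / P) *s axis 0 1) e"
  proof (rule frame_formsI)
    show "invertible (K l)" for l by (rule splittingD(3)[OF K])
    have "K l $ i $ 1 *s ((C / P) *s axis 0 1) + K l $ i $ 2 *s (\<Sum>k\<le>2. l ^ k *s e k)
      = frame_U f x l $ i $ 1 *s (C *s axis 0 1) + frame_U f x l $ i $ 2 *s quad_form l" for l i
      using nz G11(1)[of l] G12[of l] G22(1)[of l]
      unfolding sum_e KG(1) matrix_mult_2_nth
      by (simp add: vec_eq_iff P_def[symmetric] R_def[symmetric] field_simps)
    then show "K l $ 1 $ 1 *s ((C / P) *s axis 0 1) + K l $ 1 $ 2 *s (\<Sum>k\<le>2. l ^ k *s e k) = dwU f x l $ 1"
      "K l $ 2 $ 1 *s ((C / P) *s axis 0 1) + K l $ 2 $ 2 *s (\<Sum>k\<le>2. l ^ k *s e k) = dwU f x l $ 2" for l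
      using frame_U_forms[OF c, of l] by (simp_all add: C_def)
  qed
  then show "\<exists>\<delta>. frame_forms f x K ((poly (pderiv f) (x $ 0) / K' 0 $ 1 $ 1) *s axis 0 1)
           (\<lambda>k. (1 / K' 0 $ 2 $ 2) *s E_form k + \<delta> k *s axis 0 1)"
    unfolding p r e_def P_def R_def C_def
    by (intro exI[where x = "\<lambda>k. - s k * poly (pderiv f) (x $ 0) / (G 0 $ 1 $ 1 * G 0 $ 2 $ 2)"])
qed

section \<open>Quadratic forms of rank three\<close>

text \<open>With \<open>a = 1\<close>, \<open>b = -2\<close> this is the discriminant metric of the
  constant spatial forms; with \<open>b = -1/2\<close> it is the inverse of that metric on the
  kernel of \<open>dx_0\<close>.\<close>

definition quadric :: "complex \<Rightarrow> complex \<Rightarrow> complex^4^4" where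
  "quadric a b = (\<chi> i j. if i = 2 \<and> j = 2 then a
     else if i = 1 \<and> j = 3 \<or> i = 3 \<and> j = 1 then b else 0)"

lemma disc_metric_E_form: "disc_metric E_form = quadric 1 (-2)"
  unfolding vec_eq_iff all_4 by (simp add: disc_metric_def quadric_def axis_def)

lemma rows_eq_range: "rows A = range (($) A)"
  by (auto simp: rows_def row_def)

text \<open>The nonzero rows are nonzero multiples of three standard basis vectors, which therefore
  span the row space.\<close>

lemma rank_quadric:
  assumes "a \<noteq> 0" "b \<noteq> 0"
  shows "rank (quadric a b) = 3"
proof -
  let ?B = "{axis 1 1, axis 2 1, axis 3 1} :: (complex^4) set"
  have row: "quadric a b $ 0 = 0" "quadric a b $ 1 = b *s axis 3 1"
    "quadric a b $ 2 = a *s axis 2 1" "quadric a b $ 3 = b *s axis 1 1"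
    unfolding vec_eq_iff all_4 by (simp_all add: quadric_def axis_def)
  have "quadric a b $ i \<in> vec.span ?B" for i
    by (cases i rule: cases_4) (auto simp: row intro: vec.span_base vec.span_scale vec.span_zero)
  then have 1: "rows (quadric a b) \<subseteq> vec.span ?B"
    by (auto simp: rows_eq_range)
  have "quadric a b $ i \<in> vec.span (rows (quadric a b))" for i
    by (rule vec.span_base) (auto simp: rows_eq_range)
  from vec.span_scale[OF this[of 3], of "1/b"] vec.span_scale[OF this[of 2], of "1/a"]
    vec.span_scale[OF this[of 1], of "1/b"]
  have 2: "?B \<subseteq> vec.span (rows (quadric a b))"
    using assms by (simp add: row)
  have "vec.independent ?B"
    by (rule vec.independent_mono[OF independent_cart_basis]) (auto simp: cart_basis_def)
  moreover have "vec.span ?B = vec.span (rows (quadric a b))"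
    using 1 2 by (simp add: vec.span_eq)
  moreover have "card ?B = 3"
    by (simp add: axis_eq_axis)
  ultimately show ?thesis
    unfolding row_rank_def_gen using vec.dim_eq_card by metis
qed

text \<open>The discriminant of such forms is a multiple of \<open>dx_0^2\<close>. This excludes
  zeros of the common factor of the spatial forms belonging to a global clock.\<close>

lemma rank_disc_degenerate:
  assumes "\<And>k. k \<le> 2 \<Longrightarrow> e k = \<delta> k *s axis 0 1"
  shows "rank (disc_metric e) \<le> 1"
proof -
  have e: "e 0 = \<delta> 0 *s axis 0 1" "e (Suc 0) = \<delta> (Suc 0) *s axis 0 1" "e 2 = \<delta> 2 *s axis 0 1"
    using assms by auto
  have "disc_metric e $ i = (disc_metric e $ i $ 0) *s axis 0 1" for i
    unfolding vec_eq_iff all_4 by (simp add: disc_metric_def e axis_def)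
  then have "disc_metric e $ i \<in> vec.span {axis 0 1}" for i
    by (metis insertI1 vec.span_base vec.span_scale)
  then have "rows (disc_metric e) \<subseteq> vec.span {axis 0 1}"
    by (auto simp: rows_eq_range)
  from vec.dim_le_card[OF this] show ?thesis
    by (simp add: row_rank_def_gen)
qed

lemma quadric_kernel:
  "quadric 1 (-1/2) *v \<alpha> = 0 \<longleftrightarrow> (\<exists>c. \<alpha> = c *s axis 0 1)"
proof -
  have "quadric 1 (-1/2) *v \<alpha> = 0 \<longleftrightarrow> \<alpha> $ 1 = 0 \<and> \<alpha> $ 2 = 0 \<and> \<alpha> $ 3 = 0"
    unfolding vec_eq_iff all_4
    by (auto simp: matrix_vector_mult_def sum_UNIV_4 quadric_def)
  also have "\<dots> \<longleftrightarrow> (\<exists>c. \<alpha> = c *s axis 0 1)"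
    unfolding vec_eq_iff all_4 by (auto simp: axis_def)
  finally show ?thesis .
qed

text \<open>For \<open>v $ 0 = 0\<close> the \<open>dx_0\<close> terms of the forms affect only
  component 0 of the covector, which \<open>quadric\<close> kills. The factor \<open>q^2\<close>
  cancels \<open>1/q\<close> twice, and \<open>-1/2\<close> inverts \<open>-2\<close>.\<close>

lemma inverse_on_kernel_quadric:
  assumes "c \<noteq> 0" "q \<noteq> 0"
  shows "inverse_on_kernel (c *s axis 0 1)
    (\<chi> i j. q^2 * disc_metric (\<lambda>k. (1 / q) *s E_form k + \<delta> k *s axis 0 1) $ i $ j) (quadric 1 (-1/2))"
  unfolding inverse_on_kernel_def
proof (intro allI impI)
  fix v :: "complex^4"
  assume "contract (c *s axis 0 1) v = 0"
  then have v0: "v $ 0 = 0"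
    using assms by (simp add: contract_def sum_UNIV_4 axis_def)
  show "quadric 1 (-1/2) *v ((\<chi> i j. q^2 *
      disc_metric (\<lambda>k. (1 / q) *s E_form k + \<delta> k *s axis 0 1) $ i $ j) *v v) = v"
    unfolding vec_eq_iff all_4
    using assms v0
    by (simp add: matrix_vector_mult_def sum_UNIV_4 quadric_def disc_metric_def axis_def power2_eq_square)
qed

section \<open>Locality of derivatives and the flat model\<close>

lemma pd_cong_open:
  assumes "open W" "x \<in> W" "\<And>y. y \<in> W \<Longrightarrow> g y = h y"
  shows "pd i g x = pd i h x"
  unfolding pd_def
proof (rule deriv_cong_ev)
  have "continuous_on UNIV (\<lambda>t::complex. x + axis i t)"
  proof -
    have "continuous_on UNIV (\<lambda>t::complex. if j = i then t else 0)" for j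
      by (cases "j = i") auto
    then show ?thesis
      unfolding axis_def by (intro continuous_intros continuous_on_vec_lambda)
  qed
  then have "open ((\<lambda>t. x + axis i t) -` W)"
    using assms(1) by (simp add: continuous_on_open_vimage)
  moreover have "0 \<in> (\<lambda>t. x + axis i t) -` W"
    using assms(2) by (simp add: axis_def zero_vec_def[symmetric])
  ultimately have "\<forall>\<^sub>F t in nhds 0. t \<in> (\<lambda>t. x + axis i t) -` W"
    by (rule eventually_nhds_in_open)
  then show "\<forall>\<^sub>F t in nhds 0. g (x + axis i t) = h (x + axis i t)"
    by eventually_elim (use assms(3) in auto)
qed simp

lemma mholo_cong_open:
  assumes "open W" "\<And>y. y \<in> W \<Longrightarrow> g y = h y" "mholo W g"
  shows "mholo W h"
  unfolding mholo_def
proof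
  fix x assume x: "x \<in> W"
  then obtain D where D: "(g has_derivative D) (at x)" "\<forall>c v. D (c *s v) = c * D v"
    using assms(3) unfolding mholo_def by meson
  have "(h has_derivative D) (at x)"
    by (rule has_derivative_transform_within_open[OF D(1) assms(1) x]) (rule assms(2))
  with D(2) show "\<exists>D. (h has_derivative D) (at x) \<and> (\<forall>c v. D (c *s v) = c * D v)"
    by blast
qed

text \<open>A constant \<open>h\<close> and the form \<open>dx_0\<close> are parallel for vanishing
  Christoffel symbols. As \<theta> is prescribed only on \<open>W\<close>, its derivatives are found
  by locality.\<close>

lemma newton_cartan_flat:
  assumes W: "open W" and \<theta>: "\<And>y. y \<in> W \<Longrightarrow> \<theta> y = axis 0 1"
  shows "newton_cartan W (\<lambda>_. quadric 1 (-1/2)) \<theta> (\<lambda>_ _ _ _. 0)"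
proof -
  have "mholo W (\<lambda>x. \<theta> x $ i)" for i
    by (rule mholo_cong_open[OF W _ mholo_const[of _ "axis 0 1 $ i"]]) (simp add: \<theta>)
  moreover have "pd i (\<lambda>y. \<theta> y $ j) x = 0" if "x \<in> W" for x i j
    using pd_cong_open[OF W that, of "\<lambda>y. \<theta> y $ j" "\<lambda>_. axis 0 1 $ j"] \<theta> by simp
  moreover have "transpose (quadric 1 (-1/2)) = quadric 1 (-1/2)"
    by (auto simp: vec_eq_iff transpose_def quadric_def)
  ultimately show ?thesis
    using W \<theta> quadric_kernel
    by (auto simp: newton_cartan_def holo_form_def closed_form_def rank_quadric mholo_const)
qed

section \<open>Openness and density of the generic locus\<close>

lemma open_generic: "open {x::complex^4. poly p (x $ 0) \<noteq> 0}"
proof -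
  have "continuous_on UNIV (\<lambda>x::complex^4. poly p (x $ 0))"
    by (intro mholo_imp_continuous_on mholo_intros)
  then show ?thesis
    by (intro open_Collect_neq) auto
qed

text \<open>Moving the coordinate \<open>x $ 0\<close> alone suffices: a disc is infinite, whereas
  \<open>p\<close> has finitely many roots.\<close>

lemma closure_generic:
  assumes "p \<noteq> 0"
  shows "closure {x::complex^4. poly p (x $ 0) \<noteq> 0} = UNIV"
proof -
  have "x \<in> closure {x. poly p (x $ 0) \<noteq> 0}" for x :: "complex^4"
    unfolding closure_approachable
  proof (intro allI impI)
    fix \<epsilon> :: real assume "\<epsilon> > 0"
    then have "infinite (ball (x $ 0) \<epsilon>)"
      using uncountable_ball uncountable_infinite by blast
    then have "infinite (ball (x $ 0) \<epsilon> - {z. poly p z = 0})"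
      using poly_roots_finite[OF assms] by simp
    then have "ball (x $ 0) \<epsilon> - {z. poly p z = 0} \<noteq> {}"
      by (rule infinite_imp_nonempty)
    then obtain t where t: "t \<in> ball (x $ 0) \<epsilon>" "poly p t \<noteq> 0"
      by blast
    have "norm (axis 0 (t - x $ 0) :: complex^4) = norm (t - x $ 0)"
      by (simp add: norm_vec_def L2_set_def sum_UNIV_4 axis_def)
    then have "dist (x + axis 0 (t - x $ 0)) x < \<epsilon>"
      using t(1) by (simp add: dist_norm norm_minus_commute)
    moreover have "(x + axis 0 (t - x $ 0)) $ 0 = t"
      by (simp add: axis_def)
    ultimately show "\<exists>y\<in>{x. poly p (x $ 0) \<noteq> 0}. dist y x < \<epsilon>"
      using t(2) by (intro bexI[of _ "x + axis 0 (t - x $ 0)"]) auto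
  qed
  then show ?thesis by auto
qed

lemma mholo_eq_on_dense:
  assumes "mholo UNIV g" "mholo UNIV h" "closure S = UNIV" "\<And>x. x \<in> S \<Longrightarrow> g x = h x"
  shows "g x = h x"
proof -
  have "continuous_on (closure S) (\<lambda>x. g x - h x)"
    unfolding assms(3) by (intro mholo_imp_continuous_on mholo_diff assms)
  from continuous_constant_on_closure[OF this, of 0 x] assms(3,4) show ?thesis
    by simp
qed

text \<open>\<open>f'(S|)\<close> is entire in \<lambda>, so its Laurent expansion is a Taylor
  series with constant term the value at \<open>0\<close>.\<close>

lemma gamma0_eq: "gamma0 f x = poly (pderiv f) (x $ 0)"
proof -
  define h where "h l = poly (pderiv f) (cubic x l)" for l
  have "h holomorphic_on UNIV"
    unfolding h_def using holomorphic_cubic[of x UNIV] by (intro holomorphic_intros)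
  then have "h analytic_on UNIV"
    by (simp add: analytic_on_open)
  then have "h analytic_on {0}"
    by (rule analytic_on_subset) simp
  then have "h has_fps_expansion fps_expansion h 0"
    by (rule analytic_at_imp_has_fps_expansion_0)
  from has_fps_expansion_imp_0_eq_fps_nth_0[OF this]
    laurent_expansion_0_eqI[OF has_laurent_expansion_fps[OF this]]
  show ?thesis
    by (simp add: gamma0_def h_def[abs_def])
qed

section \<open>The local Newton-Cartan geometry\<close>

text \<open>By \<open>frame_of_splitting\<close> any holomorphic frame has clock
  \<open>(c/p) dx_0\<close> and spatial forms \<open>dx_(k+1) / q\<close> modulo
  \<open>dx_0\<close>. Rescaling the clock by \<open>p/c\<close> and the metric by
  \<open>q^2\<close> leads to the flat model.\<close>

lemma locally_newton_cartan_holds: "locally_newton_cartan f"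
  unfolding locally_newton_cartan_def
proof (intro conjI ballI allI impI)
  fix x assume "x \<in> normal_type f 0 2"
  \<comment> \<open>One explicit frame serves all generic points at once.\<close>
  let ?W = "{x. poly (pderiv f) (x $ 0) \<noteq> 0}"
  have "mholo ?W (\<lambda>x. frame_U f x z $ i $ j)" "mholo ?W (\<lambda>x. frame_V f x z $ i $ j)" for z i j
    using exhaust_2[of i] exhaust_2[of j]
    by (auto simp: frame_U_def frame_V_def Let_def intro!: mholo_intros)
  then have "holo_frame f ?W (frame_U f) (frame_V f)"
    by (auto simp: holo_frame_def open_generic splitting_frame)
  then show "\<exists>W H H'. x \<in> W \<and> holo_frame f W H H'"
    using \<open>x \<in> normal_type f 0 2\<close> unfolding normal_type_0_2
    by (intro exI[of _ ?W] exI[of _ "frame_U f"] exI[of _ "frame_V f"] conjI)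
next
  fix W H H' assume HF: "holo_frame f W H H'"
  define c p q where "c x = poly (pderiv f) (x $ 0)" and "p x = H' x 0 $ 1 $ 1"
    and "q x = H' x 0 $ 2 $ 2" for x
  have spl: "splitting (normal_patch f x) 0 2 (H x) (H' x)" if "x \<in> W" for x
    using HF that by (simp add: holo_frame_def)
  have c: "c x \<noteq> 0" if "x \<in> W" for x
    using spl[OF that] normal_type_0_2[of f] by (auto simp: c_def normal_type_def)
  note frame = frame_of_splitting[OF c[unfolded c_def] spl, folded c_def p_def q_def]
  have "\<forall>x\<in>W. \<exists>\<delta>. frame_forms f x (H x) ((c x / p x) *s axis 0 1)
      (\<lambda>k. (1 / q x) *s E_form k + \<delta> k *s axis 0 1)"
    using frame(4) by blast
  from bchoice[OF this] obtain \<delta> where \<delta>: "\<forall>x\<in>W. frame_forms f x (H x) ((c x / p x) *s axis 0 1)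
      (\<lambda>k. (1 / q x) *s E_form k + \<delta> x k *s axis 0 1)"
    by blast
  have W: "open W" using HF by (simp add: holo_frame_def)
  \<comment> \<open>\<open>p\<close> and \<open>q\<close> are entries of \<open>H' x 0\<close>, so
    the holomorphic dependence of the frame on \<open>x\<close> passes to the rescaling
    factors.\<close>
  have mh: "mholo W (\<lambda>x. p x / c x)" "mholo W (\<lambda>x. (q x)^2)"
    using HF c by (auto simp: holo_frame_def p_def q_def c_def intro!: mholo_intros)
  have NC: "newton_cartan W (\<lambda>_. quadric 1 (-1/2)) (\<lambda>y. (p y / c y) *s ((c y / p y) *s axis 0 1)) (\<lambda>_ _ _ _. 0)"
    using c frame(1) by (intro newton_cartan_flat[OF W]) simp
  have inv: "inverse_on_kernel ((c y / p y) *s axis 0 1)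
      (\<chi> i j. (q y)^2 * disc_metric (\<lambda>k. (1 / q y) *s E_form k + \<delta> y k *s axis 0 1) $ i $ j)
      (quadric 1 (-1/2))" if "y \<in> W" for y
    using c[OF that] frame(1,2)[OF that that] by (intro inverse_on_kernel_quadric) auto
  show "\<exists>\<theta> e. (\<forall>x\<in>W. frame_forms f x (H x) (\<theta> x) (\<lambda>k. e k x)) \<and>
          (\<forall>x\<in>W. \<exists>V a b h \<Gamma>. x \<in> V \<and> V \<subseteq> W \<and>
             mholo V a \<and> mholo V b \<and> (\<forall>y\<in>V. a y \<noteq> 0 \<and> b y \<noteq> 0) \<and>
             newton_cartan V h (\<lambda>y. a y *s \<theta> y) \<Gamma> \<and>
             (\<forall>y\<in>V. inverse_on_kernel (\<theta> y)
                (\<chi> i j. b y * disc_metric (\<lambda>k. e k y) $ i $ j) (h y)))"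
  proof (intro exI[of _ "\<lambda>x. (c x / p x) *s axis 0 1"]
      exI[of _ "\<lambda>k x. (1 / q x) *s E_form k + \<delta> x k *s axis 0 1"] conjI ballI)
    fix x assume "x \<in> W"
    then show "frame_forms f x (H x) ((c x / p x) *s axis 0 1)
        (\<lambda>k. (1 / q x) *s E_form k + \<delta> x k *s axis 0 1)"
      using \<delta> by blast
    show "\<exists>V a b h \<Gamma>. x \<in> V \<and> V \<subseteq> W \<and>
             mholo V a \<and> mholo V b \<and> (\<forall>y\<in>V. a y \<noteq> 0 \<and> b y \<noteq> 0) \<and>
             newton_cartan V h (\<lambda>y. a y *s ((c y / p y) *s axis 0 1)) \<Gamma> \<and>
             (\<forall>y\<in>V. inverse_on_kernel ((c y / p y) *s axis 0 1)
                (\<chi> i j. b y * disc_metric (\<lambda>k. (1 / q y) *s E_form k + \<delta> y k *s axis 0 1) $ i $ j) (h y))"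
      by (intro exI[of _ W] exI[of _ "\<lambda>x. p x / c x"] exI[of _ "\<lambda>x. (q x)^2"]
          exI[of _ "\<lambda>_. quadric 1 (-1/2)"] exI[of _ "\<lambda>_ _ _ _. 0"] conjI mh NC ballI inv)
        (use \<open>x \<in> W\<close> c frame(1,2) in auto)
  qed
qed

section \<open>The clock on all of \<open>M\<close>\<close>

text \<open>The witness is \<open>\<gamma>_0 dx_0\<close> with constant spatial forms, realised by
  \<open>frame_U\<close>, whose determinant is 1. It is closed because \<open>\<gamma>_0\<close>
  depends on \<open>x $ 0\<close> alone.\<close>

lemma ex_global_clock: "\<exists>\<theta>. global_clock f \<theta> \<and> closed_form UNIV \<theta>"
proof (intro exI conjI)
  let ?\<theta> = "\<lambda>x::complex^4. poly (pderiv f) (x $ 0) *s (axis 0 1 :: complex^4)"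
  have "holo_form UNIV ?\<theta>"
    unfolding holo_form_def vector_smult_component by (intro allI mholo_intros)
  moreover have "\<forall>k\<le>2. holo_form UNIV (\<lambda>x. E_form k)"
    unfolding holo_form_def by (intro allI impI mholo_intros)
  moreover have "rank (disc_metric E_form) = 3"
    by (simp add: disc_metric_E_form rank_quadric)
  moreover have "\<forall>x\<in>normal_type f 0 2. \<exists>H H'. splitting (normal_patch f x) 0 2 H H' \<and>
      (\<forall>l. det (H l) = 1) \<and> frame_forms f x H (?\<theta> x) E_form"
    unfolding normal_type_0_2
    using splitting_frame det_frame_U frame_forms_frame_U by fast
  ultimately show "global_clock f ?\<theta>"
    unfolding global_clock_def by (intro conjI exI[of _ "\<lambda>k x. E_form k"]) simp_all
  have "pd i (\<lambda>y. ?\<theta> y $ j) x = pd j (\<lambda>y. ?\<theta> y $ i) x" for i j x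
  proof -
    have "pd i (\<lambda>y. ?\<theta> y $ j) x = poly (pderiv (pderiv f)) (x $ 0) * axis 0 1 $ i * axis 0 1 $ j" for i j
      by (cases "j = 0") (auto simp: axis_def pd_poly_nth0[unfolded axis_def])
    then show ?thesis by simp
  qed
  then show "closed_form UNIV ?\<theta>"
    by (simp add: closed_form_def)
qed

text \<open>All frames at a generic point induce nonzero multiples of \<open>dx_0\<close> as clocks;
  the factor is the ratio of the entries \<open>K' 0 $ 1 $ 1\<close> and
  \<open>H' 0 $ 1 $ 1\<close>.\<close>

lemma global_clock_frame:
  assumes clock: "global_clock f \<theta>" and x: "x \<in> normal_type f 0 2"
    and spl: "splitting (normal_patch f x) 0 2 H H'"
  shows "\<exists>c e. c \<noteq> 0 \<and> frame_forms f x H (c *s \<theta> x) e"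
proof -
  have c: "poly (pderiv f) (x $ 0) \<noteq> 0" using x by (simp add: normal_type_0_2)
  obtain K K' e where K: "splitting (normal_patch f x) 0 2 K K'" "frame_forms f x K (\<theta> x) e"
    using clock x unfolding global_clock_def by meson
  obtain \<delta> where \<theta>: "\<theta> x = (poly (pderiv f) (x $ 0) / K' 0 $ 1 $ 1) *s axis 0 1"
    using frame_forms_unique(1)[OF K(2)] frame_of_splitting(4)[OF c K(1)] by meson
  note nz = frame_of_splitting(1)[OF c K(1)] frame_of_splitting(1)[OF c spl]
  have "(K' 0 $ 1 $ 1 / H' 0 $ 1 $ 1) *s \<theta> x = (poly (pderiv f) (x $ 0) / H' 0 $ 1 $ 1) *s axis 0 1"
    using nz by (simp add: \<theta>)
  then show ?thesis
    using frame_of_splitting(4)[OF c spl] nz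
    by (intro exI[of _ "K' 0 $ 1 $ 1 / H' 0 $ 1 $ 1"]) auto
qed

text \<open>
  On the generic locus \<open>\<theta> = (\<gamma>\<^sub>0/P) dx\<^sub>0\<close> and \<open>e\<^sub>k = P dx\<^sub>k\<^sub>+\<^sub>1\<close> modulo \<open>dx\<^sub>0\<close> with the same factor \<open>P\<close>,
  because \<open>det H = 1\<close>. The identities in the proof that express this extend to \<open>M\<close> by density, and a zero
  of \<open>P\<close> would make the spatial metric degenerate.
\<close>

lemma global_clock_eq_0_iff:
  assumes clock: "global_clock f \<theta>" and f': "pderiv f \<noteq> 0"
  shows "\<theta> x = 0 \<longleftrightarrow> x \<in> normal_type f (-1) 3"
proof -
  obtain e where hol: "\<And>i. mholo UNIV (\<lambda>x. \<theta> x $ i)" "\<And>k i. k \<le> 2 \<Longrightarrow> mholo UNIV (\<lambda>x. e k x $ i)"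
    and rank: "\<And>x. rank (disc_metric (\<lambda>k. e k x)) = 3"
    and spl: "\<And>x. x\<in>normal_type f 0 2 \<Longrightarrow> \<exists>H H'. splitting (normal_patch f x) 0 2 H H' \<and>
              (\<forall>l. det (H l) = 1) \<and> frame_forms f x H (\<theta> x) (\<lambda>k. e k x)"
    using clock unfolding global_clock_def holo_form_def by blast
  have dense: "closure (normal_type f 0 2) = UNIV"
    unfolding normal_type_0_2 by (rule closure_generic[OF f'])
  \<comment> \<open>The factor \<open>P\<close> is written as \<open>e 0 x $ 1\<close>, because
    \<open>E_form 0\<close> is \<open>dx_1\<close>. In this form it is holomorphic on all of
    \<open>M\<close>, as the extension by density requires.\<close>
  have generic: "\<theta> x $ 0 * e 0 x $ 1 = poly (pderiv f) (x $ 0)" "i \<noteq> 0 \<Longrightarrow> \<theta> x $ i = 0"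
    "k \<le> 2 \<Longrightarrow> i \<noteq> 0 \<Longrightarrow> e k x $ i = e 0 x $ 1 * E_form k $ i"
    if x: "x \<in> normal_type f 0 2" for x i k
  proof -
    have c: "poly (pderiv f) (x $ 0) \<noteq> 0" using x by (simp add: normal_type_0_2)
    obtain H H' where H: "splitting (normal_patch f x) 0 2 H H'" "\<forall>l. det (H l) = 1"
        "frame_forms f x H (\<theta> x) (\<lambda>k. e k x)"
      using spl[OF x] by blast
    define p q where "p = H' 0 $ 1 $ 1" and "q = H' 0 $ 2 $ 2"
    note frame = frame_of_splitting[OF c H(1), folded p_def q_def]
    \<comment> \<open>\<open>det H\<close> equals \<open>p * q\<close>, so the normalisation makes
      the factor \<open>1/q\<close> of the spatial forms the inverse of the factor
      \<open>1/p\<close> of the clock.\<close>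
    have pq: "1 / q = p" using frame(2) frame(3)[of 0] H(2) by (simp add: field_simps)
    obtain \<delta> where "frame_forms f x H ((poly (pderiv f) (x $ 0) / p) *s axis 0 1)
           (\<lambda>k. (1 / q) *s E_form k + \<delta> k *s axis 0 1)"
      using frame(4) by blast
    note eq = frame_forms_unique[OF H(3) this, unfolded pq]
    show "\<theta> x $ 0 * e 0 x $ 1 = poly (pderiv f) (x $ 0)"
      using frame(1) eq(2)[of 0] by (simp add: eq(1) axis_def)
    show "\<theta> x $ i = 0" if "i \<noteq> 0"
      using that by (simp add: eq(1) axis_def)
    show "e k x $ i = e 0 x $ 1 * E_form k $ i" if "k \<le> 2" "i \<noteq> 0"
      using that by (simp add: eq(2) axis_def)
  qed
  have ext: "\<theta> x $ 0 * e 0 x $ 1 = poly (pderiv f) (x $ 0)" "i \<noteq> 0 \<Longrightarrow> \<theta> x $ i = 0"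
    "k \<le> 2 \<Longrightarrow> i \<noteq> 0 \<Longrightarrow> e k x $ i = e 0 x $ 1 * E_form k $ i" for i k
  proof -
    show "\<theta> x $ 0 * e 0 x $ 1 = poly (pderiv f) (x $ 0)"
      by (rule mholo_eq_on_dense[OF _ _ dense generic(1)]) (intro mholo_intros hol order_refl le0)+
    show "\<theta> x $ i = 0" if "i \<noteq> 0"
      by (rule mholo_eq_on_dense[OF hol(1) mholo_const dense generic(2)]) (use that in auto)
    show "e k x $ i = e 0 x $ 1 * E_form k $ i" if "k \<le> 2" "i \<noteq> 0"
      by (rule mholo_eq_on_dense[OF hol(2) mholo_mult[OF hol(2) mholo_const] dense generic(3)])
         (use that in auto)
  qed
  have "e 0 x $ 1 \<noteq> 0"
  proof
    assume "e 0 x $ 1 = 0"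
    then have "e k x = (e k x $ 0) *s axis 0 1" if "k \<le> 2" for k
      using ext(3)[OF that] by (simp add: vec_eq_iff axis_def)
    from rank_disc_degenerate[of "\<lambda>k. e k x", OF this] rank[of x] show False by simp
  qed
  then have "\<theta> x $ 0 = 0 \<longleftrightarrow> poly (pderiv f) (x $ 0) = 0"
    using ext(1) by (metis mult_eq_0_iff)
  moreover have "\<theta> x = 0 \<longleftrightarrow> \<theta> x $ 0 = 0"
    using ext(2) by (metis vec_eq_iff zero_index)
  ultimately show ?thesis
    by (simp add: normal_type_jump)
qed

section \<open>The induced two-forms\<close>

lemma dwV_nth:
  "dwV f x m $ 1 = poly (pderiv f) (x $ 0) *s axis 0 1"
  "dwV f x m $ 2 $ 0 = m^3" "dwV f x m $ 2 $ 1 = m^2" "dwV f x m $ 2 $ 2 = m" "dwV f x m $ 2 $ 3 = 1"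
proof -
  show "dwV f x m $ 1 = poly (pderiv f) (x $ 0) *s axis 0 1"
    by (simp add: vec_eq_iff dwV_def pd_poly_nth0)
  show "dwV f x m $ 2 $ 0 = m^3" "dwV f x m $ 2 $ 1 = m^2" "dwV f x m $ 2 $ 2 = m" "dwV f x m $ 2 $ 3 = 1"
    by (simp_all add: dwV_def, rule_tac [!] pd_eqI)
       (auto simp: rev_cubic_def axis_def intro!: derivative_eq_intros)
qed

text \<open>In the second chart the form is \<open>\<gamma>_0 dx_0\<close> wedged with
  \<open>m^3 dx_0 + m^2 dx_1 + m dx_2 + dx_3\<close>. The cubic term drops out as
  \<open>dx_0\<close> meets itself, and the coefficient of \<open>m^k\<close> involves
  \<open>dx_(3-k)\<close>, that is \<open>E_form (2 - k)\<close>.\<close>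

lemma ex_induced_two_forms:
  "\<exists>\<Sigma>. induced_two_forms f \<Sigma> \<and> (\<forall>x. x \<in> normal_type f (-1) 3 \<longleftrightarrow> (\<forall>k\<le>2. \<Sigma> k x = 0))"
proof (intro exI conjI allI)
  let ?\<Sigma> = "\<lambda>k x. (\<chi> i j. poly (pderiv f) (x $ 0) * wedge (axis 0 1) (E_form (2 - k)) $ i $ j) :: complex^4^4"
  have "wedge (dwV f x m $ 1) (dwV f x m $ 2) $ i $ j = (\<Sum>k\<le>2. m^k * ?\<Sigma> k x $ i $ j)" for x m i j
    by (cases i rule: cases_4; cases j rule: cases_4)
       (simp_all add: wedge_def dwV_nth atMost_nat_numeral axis_def)
  moreover have "mholo UNIV (\<lambda>x. ?\<Sigma> k x $ i $ j)" for k i j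
    unfolding vec_lambda_beta by (intro mholo_intros)
  ultimately show "induced_two_forms f ?\<Sigma>"
    unfolding induced_two_forms_def by blast
  fix x
  show "x \<in> normal_type f (-1) 3 \<longleftrightarrow> (\<forall>k\<le>2. ?\<Sigma> k x = 0)"
  proof
    assume "\<forall>k\<le>2. ?\<Sigma> k x = 0"
    then have "?\<Sigma> 0 x = 0" by blast
    \<comment> \<open>The component \<open>(0, 3)\<close> of \<open>dx_0\<close> wedge
      \<open>dx_3\<close> is 1, so this entry is \<open>\<gamma>_0\<close> itself.\<close>
    then have "?\<Sigma> 0 x $ 0 $ 3 = (0 :: complex^4^4) $ 0 $ 3" by (rule arg_cong)
    then show "x \<in> normal_type f (-1) 3"
      by (simp add: normal_type_jump wedge_def axis_def)
  qed (simp add: normal_type_jump vec_eq_iff)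
qed

text \<open>The first three conjuncts justify working with \<open>complex^4\<close> in place of
  \<open>M\<close>. Genericity is rendered as openness and density.\<close>

theorem theorem4p1:
  fixes f :: "complex poly"
  assumes "degree f \<ge> 2"
  shows
    "(\<forall>x. \<exists>!p. p \<in> sections f \<and> has_coords p x) \<and>
     (\<forall>p\<in>sections f. \<exists>!x. has_coords p x) \<and>
     (\<forall>z \<mu>. mholo UNIV (\<lambda>x. wU f x z $ \<mu>) \<and> mholo UNIV (\<lambda>x. wV f x z $ \<mu>)) \<and>
     locally_newton_cartan f \<and>
     open (normal_type f 0 2) \<and> closure (normal_type f 0 2) = UNIV \<and>
     - normal_type f 0 2 = normal_type f (-1) 3 \<and> normal_type f (-1) 3 \<noteq> {} \<and>
     (\<exists>\<theta>. global_clock f \<theta> \<and> closed_form UNIV \<theta>) \<and>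
     (\<forall>\<theta>. global_clock f \<theta> \<longrightarrow>
        (\<forall>x\<in>normal_type f 0 2. \<forall>H H'. splitting (normal_patch f x) 0 2 H H' \<longrightarrow>
           (\<exists>c e. c \<noteq> 0 \<and> frame_forms f x H (c *s \<theta> x) e)) \<and>
        (\<forall>x. \<theta> x = 0 \<longleftrightarrow> x \<in> normal_type f (-1) 3)) \<and>
     (\<exists>\<Sigma>. induced_two_forms f \<Sigma> \<and>
        (\<forall>x. x \<in> normal_type f (-1) 3 \<longleftrightarrow> (\<forall>k\<le>2. \<Sigma> k x = 0))) \<and>
     (\<forall>x. x \<in> normal_type f (-1) 3 \<longleftrightarrow> gamma0 f x = 0)"
proof -
  \<comment> \<open>Degree at least two makes \<open>f'\<close> nonconstant: being nonzero it gives
    density of the generic locus, and having a root it gives a jumping point.\<close>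
  have deg: "degree (pderiv f) > 0" using assms by (simp add: degree_pderiv)
  then have f': "pderiv f \<noteq> 0" by auto
  obtain r where "poly (pderiv f) r = 0"
    using alg_closed_imp_poly_has_root[OF deg] by blast
  then have "axis 0 r \<in> normal_type f (-1) 3"
    by (simp add: normal_type_jump axis_def)
  then have nonempty: "normal_type f (-1) 3 \<noteq> {}" by blast
  have unique: "\<exists>!p. p \<in> sections f \<and> has_coords p x" for x
    using section_unique explicit_curve_section explicit_curve_coords by metis
  have hol: "mholo UNIV (\<lambda>x. wU f x z $ \<mu>) \<and> mholo UNIV (\<lambda>x. wV f x z $ \<mu>)" for z \<mu>
  proof -
    have "mholo UNIV (\<lambda>x. - tail f x z)" "mholo UNIV (\<lambda>x. cubic x z)"
      "mholo UNIV (\<lambda>x. poly f (x $ 0))" "mholo UNIV (\<lambda>x. rev_cubic x z)"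
      unfolding rev_cubic_def by (intro mholo_intros)+
    then show ?thesis using exhaust_2[of \<mu>] by auto
  qed
  have compl: "- normal_type f 0 2 = normal_type f (-1) 3"
    by (auto simp: normal_type_0_2 normal_type_jump)
  have dense: "open (normal_type f 0 2)" "closure (normal_type f 0 2) = UNIV"
    unfolding normal_type_0_2 by (rule open_generic, rule closure_generic[OF f'])
  have "\<forall>\<theta>. global_clock f \<theta> \<longrightarrow>
        (\<forall>x\<in>normal_type f 0 2. \<forall>H H'. splitting (normal_patch f x) 0 2 H H' \<longrightarrow>
           (\<exists>c e. c \<noteq> 0 \<and> frame_forms f x H (c *s \<theta> x) e)) \<and>
        (\<forall>x. \<theta> x = 0 \<longleftrightarrow> x \<in> normal_type f (-1) 3)"
    by (intro allI impI conjI ballI global_clock_frame global_clock_eq_0_iff[OF _ f'])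
  moreover have "\<forall>x. x \<in> normal_type f (-1) 3 \<longleftrightarrow> gamma0 f x = 0"
    by (simp add: normal_type_jump gamma0_eq)
  ultimately show ?thesis
    by (intro conjI allI ballI unique section_has_coords hol locally_newton_cartan_holds dense compl
        nonempty ex_global_clock ex_induced_two_forms) auto
qed

end
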